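(* If $h=0$ and $0<\beta<\beta_c:=\rho(\Delta^2\Lambda)^{-1/2}$, then there is a constant $K<\infty$ not depending on $N$ such that $$\nu\Big(\exp\big(\tfrac18(\beta_c^2-\beta^2)N\,\mathcal P(\mathbf R_{12})\big)\Big)\le K,$$ where $\mathcal P(\mathbf x)=\mathbf x^{\top}\Lambda^{1/2}\mathcal V\Lambda^{1/2}\mathbf x$.
   Context: Multi-species SK model. $m\ge2$; $\Delta^2=(\Delta^2_{s,t})_{s,t=1}^m$ is a symmetric invertible nonzero real matrix with non-negative entries (not necessarily positive-definite). For each $N$, $\{1,\dots,N\}$ is partitioned into disjoint species $I_1,\dots,I_m$ with $|I_s|=\lambda_sN$, where the ratios $\lambda_s\in(0,1)$ are fixed; $\Lambda=\mathrm{diag}(\lambda_1,\dots,\lambda_m)$. The disorder $(g_{ij})_{1\le i<j\le N}$ consists of independent centered Gaussians with $\mathbb E g_{ij}^2=\Delta^2_{s,t}$ when $i\in I_s$, $j\in I_t$. For $\sigma\in\{-1,1\}^N$, $H_N(\sigma)=\frac{\beta}{\sqrt N}\sum_{i<j}g_{ij}\sigma_i\sigma_j+h\sum_i\sigma_i$, $Z_N=\sum_\sigma e^{H_N(\sigma)}$, and the Gibbs measure is $G_N(\sigma)=e^{H_N(\sigma)}/Z_N$. $\langle\cdot\rangle$ is the average over i.i.d. replicas $\sigma^1,\sigma^2,\dots$ from $G_N$ and $\nu(\cdot)=\mathbb E\langle\cdot\rangle$. Overlap vector: $\mathbf R_{12}=(R^{(1)}_{12},\dots,R^{(m)}_{12})^{\top}$,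 $R^{(s)}_{12}=\frac1{|I_s|}\sum_{i\in I_s}\sigma_i^1\sigma_i^2$. $\rho$ is the spectral radius. $\mathcal V=|\Lambda^{1/2}\Delta^2\Lambda^{1/2}|$ is obtained by replacing the eigenvalues of the symmetric matrix $\Lambda^{1/2}\Delta^2\Lambda^{1/2}$ by their absolute values in its spectral decomposition. *)

theory Defs
  imports "HOL-Probability.Probability" "Jordan_Normal_Form.Spectral_Radius"
begin

(* Species are indexed by s < m and sites by 1..N; configurations are extensional
   functions on the sites. *)

definition species_partition :: "nat \<Rightarrow> nat \<Rightarrow> (nat \<Rightarrow> real) \<Rightarrow> (nat \<Rightarrow> nat set) \<Rightarrow> bool" where
  "species_partition N m lam I \<longleftrightarrow>
     disjoint_family_on I {..<m} \<and> (\<Union>s<m. I s) = {1..N} \<and>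
     (\<forall>s<m. real (card (I s)) = lam s * real N)"

(* Entries of the variance profile may vanish, so the degenerate Gaussian is included. *)
definition centered_gaussian :: "real \<Rightarrow> real measure" where
  "centered_gaussian v =
     (if v = 0 then return borel 0 else density lborel (normal_density 0 (sqrt v)))"

definition gaussian_disorder ::
  "nat \<Rightarrow> nat \<Rightarrow> real Matrix.mat \<Rightarrow> (nat \<Rightarrow> nat set) \<Rightarrow> 'w measure
     \<Rightarrow> (nat \<Rightarrow> nat \<Rightarrow> 'w \<Rightarrow> real) \<Rightarrow> bool" where
  "gaussian_disorder N m Dsq I M g \<longleftrightarrow>
     prob_space M \<and>
     prob_space.indep_vars M (\<lambda>_. borel) (\<lambda>(i, j). g i j)
       {(i, j). i \<in> {1..N} \<and> j \<in> {1..N} \<and> i < j} \<and>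
     (\<forall>s<m. \<forall>t<m. \<forall>i\<in>I s. \<forall>j\<in>I t. i < j \<longrightarrow>
        distr M borel (g i j) = centered_gaussian (Dsq $$ (s, t)))"

definition configs :: "nat \<Rightarrow> (nat \<Rightarrow> real) set" where
  "configs N = PiE {1..N} (\<lambda>_. {-1, 1})"

definition hamiltonian ::
  "nat \<Rightarrow> real \<Rightarrow> real \<Rightarrow> (nat \<Rightarrow> nat \<Rightarrow> real) \<Rightarrow> (nat \<Rightarrow> real) \<Rightarrow> real" where
  "hamiltonian N \<beta> h g \<sigma> =
     \<beta> / sqrt (real N) * (\<Sum>(i, j) \<in> {(i, j). i \<in> {1..N} \<and> j \<in> {1..N} \<and> i < j}. g i j * \<sigma> i * \<sigma> j)
     + h * (\<Sum>i = 1..N. \<sigma> i)"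

definition partition_function ::
  "nat \<Rightarrow> real \<Rightarrow> real \<Rightarrow> (nat \<Rightarrow> nat \<Rightarrow> real) \<Rightarrow> real" where
  "partition_function N \<beta> h g = (\<Sum>\<sigma>\<in>configs N. exp (hamiltonian N \<beta> h g \<sigma>))"

definition gibbs ::
  "nat \<Rightarrow> real \<Rightarrow> real \<Rightarrow> (nat \<Rightarrow> nat \<Rightarrow> real) \<Rightarrow> (nat \<Rightarrow> real) \<Rightarrow> real" where
  "gibbs N \<beta> h g \<sigma> = exp (hamiltonian N \<beta> h g \<sigma>) / partition_function N \<beta> h g"

(* Average of a function of two independent replicas. *)
definition gibbs_average ::
  "nat \<Rightarrow> real \<Rightarrow> real \<Rightarrow> (nat \<Rightarrow> nat \<Rightarrow> real) \<Rightarrow> ((nat \<Rightarrow> real) \<Rightarrow> (nat \<Rightarrow> real) \<Rightarrow> real) \<Rightarrow> real" where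
  "gibbs_average N \<beta> h g F =
     (\<Sum>\<sigma>\<in>configs N. \<Sum>\<tau>\<in>configs N. F \<sigma> \<tau> * gibbs N \<beta> h g \<sigma> * gibbs N \<beta> h g \<tau>)"

(* For fixed N the Gibbs average is a convex combination of the finitely many values of F,
   hence a bounded random variable, so the Bochner integral is a genuine expectation. *)
definition nu ::
  "nat \<Rightarrow> real \<Rightarrow> real \<Rightarrow> 'w measure \<Rightarrow> (nat \<Rightarrow> nat \<Rightarrow> 'w \<Rightarrow> real)
     \<Rightarrow> ((nat \<Rightarrow> real) \<Rightarrow> (nat \<Rightarrow> real) \<Rightarrow> real) \<Rightarrow> real" where
  "nu N \<beta> h M g F = (LINT \<omega>|M. gibbs_average N \<beta> h (\<lambda>i j. g i j \<omega>) F)"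

definition overlap ::
  "nat \<Rightarrow> (nat \<Rightarrow> nat set) \<Rightarrow> (nat \<Rightarrow> real) \<Rightarrow> (nat \<Rightarrow> real) \<Rightarrow> real Matrix.vec" where
  "overlap m I \<sigma> \<tau> = Matrix.vec m (\<lambda>s. (\<Sum>i\<in>I s. \<sigma> i * \<tau> i) / real (card (I s)))"

definition beta_c :: "nat \<Rightarrow> real Matrix.mat \<Rightarrow> (nat \<Rightarrow> real) \<Rightarrow> real" where
  "beta_c m Dsq lam =
     spectral_radius (map_mat complex_of_real (Dsq * mat_diag m lam)) powr (- 1 / 2)"

(* V arises from a spectral decomposition A = U diag(d) U^T, U orthogonal, by replacing
   each eigenvalue d i by its absolute value. *)
definition is_spectral_abs :: "nat \<Rightarrow> real Matrix.mat \<Rightarrow> real Matrix.mat \<Rightarrow> bool" where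
  "is_spectral_abs n A V \<longleftrightarrow>
     (\<exists>U d. U \<in> carrier_mat n n \<and> transpose_mat U * U = 1\<^sub>m n \<and>
        A = U * mat_diag n d * transpose_mat U \<and>
        V = U * mat_diag n (\<lambda>i. \<bar>d i\<bar>) * transpose_mat U)"

(* For symmetric A such a V exists and does not depend on the chosen decomposition. *)
definition spectral_abs :: "nat \<Rightarrow> real Matrix.mat \<Rightarrow> real Matrix.mat" where
  "spectral_abs n A = (THE V. is_spectral_abs n A V)"

definition sqrt_Lambda :: "nat \<Rightarrow> (nat \<Rightarrow> real) \<Rightarrow> real Matrix.mat" where
  "sqrt_Lambda m lam = mat_diag m (\<lambda>s. sqrt (lam s))"

definition V_mat :: "nat \<Rightarrow> real Matrix.mat \<Rightarrow> (nat \<Rightarrow> real) \<Rightarrow> real Matrix.mat" where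
  "V_mat m Dsq lam = spectral_abs m (sqrt_Lambda m lam * Dsq * sqrt_Lambda m lam)"

definition P_form :: "nat \<Rightarrow> real Matrix.mat \<Rightarrow> (nat \<Rightarrow> real) \<Rightarrow> real Matrix.vec \<Rightarrow> real" where
  "P_form m Dsq lam x =
     scalar_prod x ((sqrt_Lambda m lam * V_mat m Dsq lam * sqrt_Lambda m lam) *\<^sub>v x)"

end

theory Submission
  imports Defs
begin

text \<open>
At \<open>h = 0\<close> the energies \<open>H \<sigma>\<close> form a centered Gaussian family with constant variance \<open>\<kappa>\<close>, so
\<open>E Z\<close> is explicit, and so is every second moment: averaging \<open>Z\<^sup>2 \<langle>F\<rangle>\<close> over the disorder leaves the
uniform average of \<open>F \<sigma> \<tau> * exp (cov \<sigma> \<tau>)\<close> over pairs of configurations, up to the factor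
\<open>(E Z)\<^sup>2\<close>. Write \<open>W = N P(R)\<close> for the weighted overlap and \<open>\<gamma> = (\<beta>\<^sub>c\<^sup>2 - \<beta>\<^sup>2) / 8\<close>. Since the absolute
value of a symmetric matrix dominates the matrix, \<open>cov \<le> (\<beta>\<^sup>2 / 2) W\<close>; since the
largest eigenvalue of this absolute value is \<open>\<rho>(\<Delta>\<^sup>2\<Lambda>) = \<beta>\<^sub>c\<^sup>-\<^sup>2\<close>, also \<open>W \<le> \<rho> \<Sum>\<^sub>s |I\<^sub>s| R\<^sub>s\<^sup>2\<close> (lemma \<open>P_form_bounds\<close>). Hence
\<open>cov + 2 \<gamma> W \<le> k \<Sum>\<^sub>s |I\<^sub>s| R\<^sub>s\<^sup>2\<close> with \<open>k = (\<beta>\<^sup>2 / \<beta>\<^sub>c\<^sup>2 + 1) / 4 < 1 / 2\<close>, and the exponential of the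
right-hand side has a mean over independent signs that is bounded uniformly in \<open>N\<close>
(\<open>sum_exp_block_squares_cube_le\<close>). This bounds \<open>E [Z\<^sup>2 \<langle>exp (2 \<gamma> W)\<rangle>] / (E Z)\<^sup>2\<close> by a constant \<open>B\<close>.

The quantity of interest carries no factor \<open>Z\<^sup>2\<close>. By the inequality between arithmetic and geometric
means, \<open>2 exp (\<gamma> W) \<le> exp (2 \<gamma> W) Z\<^sup>2 / (E Z)\<^sup>2 + (E Z)\<^sup>2 / Z\<^sup>2\<close>, so it remains to bound the
negative moment \<open>E [(E Z)\<^sup>2 / Z\<^sup>2]\<close>, that is, to show that \<open>Z\<close> is rarely much smaller than its mean.
The function \<open>log Z\<close> is convex in the disorder and its squared gradient is
\<open>\<langle>cov\<rangle> \<le> (\<beta>\<^sup>2 / 2) \<langle>W\<rangle>\<close>. So \<open>f x = (E Z / Z x)\<^sup>2\<close> and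
\<open>g y = (Z y / E Z)\<^sup>2 exp (- 2 \<beta>\<^sup>2 \<langle>W\<rangle>\<^sub>y)\<close> satisfy \<open>f x * g y \<le> exp (|x - y|\<^sup>2 / 4)\<close>, and the
Prekopa-Leindler inequality for the Gaussian measure (\<open>gaussian_transport\<close>) turns this into
\<open>E f * E g \<le> 1\<close>. Finally \<open>E g\<close> is bounded below by Jensen's inequality for the measure with
density proportional to \<open>Z\<^sup>2\<close>, because \<open>\<langle>W\<rangle>\<close> has a bounded mean under it by the second moment
computation. Everything depends on the model only through \<open>B\<close>, \<open>\<beta>\<close> and \<open>\<gamma>\<close>, which gives a constant
independent of \<open>N\<close>.
\<close>

section \<open>The Prekopa-Leindler inequality on the line\<close>

text \<open>
Borel subsets of the line are inner regular for Lebesgue measure. The regularity theorem for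
finite measures applies after restriction to bounded intervals, which then exhaust the set.
\<close>
lemma emeasure_lborel_le_of_compact:
  fixes A :: "real set" and c :: ennreal
  assumes A: "A \<in> sets borel"
    and le: "\<And>K. compact K \<Longrightarrow> K \<subseteq> A \<Longrightarrow> emeasure lborel K \<le> c"
  shows "emeasure lborel A \<le> c"
proof -
  \<comment> \<open>The restriction of Lebesgue measure to a bounded interval is a finite Borel measure.\<close>
  have bdd: "emeasure lborel (A \<inter> {-real n..real n}) \<le> c" for n :: nat
  proof -
    define M where "M = density lborel (indicator {-real n..real n} :: real \<Rightarrow> ennreal)"
    have M: "emeasure M X = emeasure lborel (X \<inter> {-real n..real n})" if "X \<in> sets borel" for X
      using that by (simp add: M_def emeasure_density Int_commute flip: indicator_inter_arith)
    have "emeasure M (A \<inter> {-real n..real n}) = (SUP K\<in>{K. K \<subseteq> A \<inter> {-real n..real n} \<and> compact K}. emeasure M K)"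
      by (rule inner_regular) (use A in \<open>auto simp: M_def emeasure_density\<close>)
    also have "\<dots> \<le> c"
    proof (rule SUP_least)
      fix K assume K: "K \<in> {K. K \<subseteq> A \<inter> {-real n..real n} \<and> compact K}"
      hence "emeasure M K = emeasure lborel K"
        by (subst M) (auto intro!: arg_cong[where f = "emeasure lborel"] borel_compact)
      with K le show "emeasure M K \<le> c" by auto
    qed
    finally show ?thesis using A by (subst (asm) M) (auto simp: Int_assoc)
  qed
  have "(\<Union>n. A \<inter> {-real n..real n}) = A"
  proof (intro equalityI subsetI)
    fix x assume "x \<in> A"
    moreover obtain n :: nat where "\<bar>x\<bar> \<le> real n" using real_arch_simple by blast
    ultimately have "x \<in> A \<inter> {-real n..real n}" by auto
    then show "x \<in> (\<Union>n. A \<inter> {-real n..real n})" by blast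
  qed auto
  moreover have "(SUP n. emeasure lborel (A \<inter> {-real n..real n})) = emeasure lborel (\<Union>n. A \<inter> {-real n..real n})"
    using A by (intro SUP_emeasure_incseq) (auto simp: incseq_def)
  moreover have "(SUP n. emeasure lborel (A \<inter> {-real n..real n})) \<le> c" by (rule SUP_least) (rule bdd)
  ultimately show ?thesis by simp
qed

lemma emeasure_lborel_add_le_of_compact:
  fixes A :: "real set" and c d :: ennreal
  assumes A: "A \<in> sets borel"
    and le: "\<And>K. compact K \<Longrightarrow> K \<subseteq> A \<Longrightarrow> emeasure lborel K + d \<le> c"
  shows "emeasure lborel A + d \<le> c"
proof (cases "d = \<infinity>")
  case True
  then show ?thesis using le[of "{}"] by simp
next
  case False
  have "emeasure lborel A \<le> c - d"
    by (rule emeasure_lborel_le_of_compact[OF A])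
      (use le False in \<open>auto simp: ennreal_le_minus_iff\<close>)
  hence "emeasure lborel A + d \<le> (c - d) + d" by (rule add_right_mono)
  also have "(c - d) + d = c" using le[of "{}"] False by (simp add: diff_add_cancel_ennreal)
  finally show ?thesis .
qed

lemma emeasure_lborel_translate:
  fixes A :: "real set"
  assumes [measurable]: "A \<in> sets borel"
  shows "emeasure lborel ((+) c ` A) = emeasure lborel A"
proof -
  have [measurable]: "(+) c ` A \<in> sets borel"
  proof -
    have "(+) c ` A = (\<lambda>x. x - c) -` A \<inter> space borel" by (auto simp: image_iff) (metis add_diff_cancel_left' diff_add_cancel add.commute)
    also have "\<dots> \<in> sets borel" by measurable
    finally show ?thesis .
  qed
  have "emeasure lborel ((+) c ` A) = emeasure (distr lborel borel ((+) c)) ((+) c ` A)"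
    by (simp add: lborel_distr_plus)
  also have "\<dots> = emeasure lborel ((+) c -` ((+) c ` A))" by (simp add: emeasure_distr)
  also have "(+) c -` ((+) c ` A) = A" by auto
  finally show ?thesis .
qed

text \<open>
For compact sets \<open>K\<close> and \<open>L\<close> the translates of \<open>K\<close> by the least element of \<open>L\<close> and of \<open>L\<close> by the
greatest element of \<open>K\<close> lie in the sumset and meet in a single point, so their measures add up.
Inner regularity extends this to Borel sets. A Borel superset \<open>C\<close> stands in for the sumset, which
need not be Borel.
\<close>
lemma brunn_minkowski_real:
  fixes A B C :: "real set"
  assumes A: "A \<in> sets borel" "A \<noteq> {}" and B: "B \<in> sets borel" "B \<noteq> {}" and C: "C \<in> sets borel"
    and sub: "\<And>a b. a \<in> A \<Longrightarrow> b \<in> B \<Longrightarrow> a + b \<in> C"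
  shows "emeasure lborel A + emeasure lborel B \<le> emeasure lborel C"
proof -
  have cpt: "emeasure lborel K + emeasure lborel L \<le> emeasure lborel C"
    if K: "compact K" "K \<subseteq> A" "K \<noteq> {}" and L: "compact L" "L \<subseteq> B" "L \<noteq> {}" for K L
  proof -
    obtain k where k: "k \<in> K" "\<And>x. x \<in> K \<Longrightarrow> x \<le> k" using compact_attains_sup[OF K(1,3)] by blast
    obtain l where l: "l \<in> L" "\<And>x. x \<in> L \<Longrightarrow> l \<le> x" using compact_attains_inf[OF L(1,3)] by blast
    have m: "K \<in> sets borel" "L \<in> sets borel" using K L borel_compact by auto
    have m': "(+) l ` K \<in> sets borel" "(+) k ` L \<in> sets borel"
      using K L by (auto intro!: borel_compact compact_translation)
    have "(+) l ` K \<inter> (+) k ` L \<subseteq> {k + l}"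
    proof (rule subsetI, elim IntE imageE)
      fix z x y assume "z = l + x" "x \<in> K" "z = k + y" "y \<in> L"
      then show "z \<in> {k + l}" using k(2)[of x] l(2)[of y] by auto
    qed
    hence "emeasure lborel ((+) l ` K \<inter> (+) k ` L) \<le> emeasure lborel {k + l}"
      by (intro emeasure_mono) auto
    hence 0: "emeasure lborel ((+) l ` K \<inter> (+) k ` L) = 0" by simp
    have "emeasure lborel K + emeasure lborel L = emeasure lborel ((+) l ` K) + emeasure lborel ((+) k ` L)"
      using m by (simp add: emeasure_lborel_translate)
    also have "\<dots> = emeasure lborel ((+) l ` K \<union> (+) k ` L)"
      using m' 0 emeasure_Un_Int[of "(+) l ` K" lborel "(+) k ` L"] by simp
    also have "\<dots> \<le> emeasure lborel C"
    proof (rule emeasure_mono)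
      show "(+) l ` K \<union> (+) k ` L \<subseteq> C" using sub k(1) l(1) K(2) L(2) by (auto simp: subset_iff) (metis add.commute)
    qed (use C in simp)
    finally show ?thesis .
  qed
  obtain a where a: "a \<in> A" using A by auto
  obtain b where b: "b \<in> B" using B by auto
  have step: "emeasure lborel A + emeasure lborel L \<le> emeasure lborel C"
    if L: "compact L" "L \<subseteq> B" "L \<noteq> {}" for L
  proof (rule emeasure_lborel_add_le_of_compact[OF A(1)])
    fix K assume "compact K" "K \<subseteq> A"
    then show "emeasure lborel K + emeasure lborel L \<le> emeasure lborel C"
      using cpt[of K L] cpt[of "{a}" L] a L by (cases "K = {}") auto
  qed
  have "emeasure lborel B + emeasure lborel A \<le> emeasure lborel C"
  proof (rule emeasure_lborel_add_le_of_compact[OF B(1)])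
    fix L assume "compact L" "L \<subseteq> B"
    then show "emeasure lborel L + emeasure lborel A \<le> emeasure lborel C"
      using step[of L] step[of "{b}"] b by (cases "L = {}") (auto simp: add.commute)
  qed
  then show ?thesis by (simp add: add.commute)
qed

lemma nn_integral_min_1_layer_cake:
  fixes f :: "real \<Rightarrow> real"
  assumes [measurable]: "f \<in> borel_measurable borel" and nonneg: "\<And>x. 0 \<le> f x"
  shows "(\<integral>\<^sup>+x. ennreal (min (f x) 1) \<partial>lborel)
    = (\<integral>\<^sup>+t. emeasure lborel {x. t < f x} * indicator {0..<1} t \<partial>lborel)"
proof -
  have "ennreal (min (f x) 1) = (\<integral>\<^sup>+t. indicator {x. t < f x} x * indicator {0..<1} t \<partial>lborel)" for x
  proof -
    have "(\<integral>\<^sup>+t. indicator {x. t < f x} x * indicator {0..<1} t \<partial>lborel)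
        = (\<integral>\<^sup>+t. indicator {0..<min (f x) 1} t \<partial>lborel)"
      by (intro nn_integral_cong) (auto simp: indicator_def)
    then show ?thesis using nonneg[of x] by simp
  qed
  hence "(\<integral>\<^sup>+x. ennreal (min (f x) 1) \<partial>lborel)
     = (\<integral>\<^sup>+x. (\<integral>\<^sup>+t. indicator {x. t < f x} x * indicator {0..<1} t \<partial>lborel) \<partial>lborel)"
    by simp
  also have "\<dots> = (\<integral>\<^sup>+t. (\<integral>\<^sup>+x. indicator {x. t < f x} x * indicator {0..<1} t \<partial>lborel) \<partial>lborel)"
    by (rule lborel_pair.Fubini') (simp add: indicator_def)
  also have "\<dots> = (\<integral>\<^sup>+t. emeasure lborel {x. t < f x} * indicator {0..<1} t \<partial>lborel)"
    by (simp add: nn_integral_multc)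
  finally show ?thesis .
qed

text \<open>
When both suprema are \<open>1\<close>, the superlevel sets of \<open>u\<close> and \<open>v\<close> at every level \<open>t < 1\<close> are nonempty, and
their sum lies in the superlevel set of \<open>w\<close>. The Brunn-Minkowski inequality is integrated over \<open>t\<close>.
Writing the hypothesis with \<open>x + y\<close> instead of the midpoint avoids rescaling the sets.
\<close>
lemma prekopa_leindler_normalized:
  fixes u v w :: "real \<Rightarrow> real"
  assumes [measurable]: "u \<in> borel_measurable borel" "v \<in> borel_measurable borel" "w \<in> borel_measurable borel"
    and u: "\<And>x. 0 \<le> u x" "\<And>x. u x \<le> 1" "\<And>t. t < 1 \<Longrightarrow> \<exists>x. t < u x"
    and v: "\<And>x. 0 \<le> v x" "\<And>x. v x \<le> 1" "\<And>t. t < 1 \<Longrightarrow> \<exists>x. t < v x"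
    and w: "\<And>x. 0 \<le> w x"
    and le: "\<And>x y. u x * v y \<le> (w (x + y))\<^sup>2"
  shows "(\<integral>\<^sup>+x. ennreal (u x) \<partial>lborel) + (\<integral>\<^sup>+x. ennreal (v x) \<partial>lborel) \<le> (\<integral>\<^sup>+x. ennreal (w x) \<partial>lborel)"
proof -
  \<comment> \<open>Both factors exceed \<open>t\<close>, so the square of \<open>w\<close> exceeds \<open>t\<^sup>2\<close>.\<close>
  have level: "emeasure lborel {x. t < u x} + emeasure lborel {x. t < v x} \<le> emeasure lborel {x. t < w x}"
    if t: "t \<in> {0..<1}" for t
  proof (rule brunn_minkowski_real)
    fix a b assume "a \<in> {x. t < u x}" "b \<in> {x. t < v x}"
    hence "t\<^sup>2 < u a * v b" using t by (auto simp: power2_eq_square intro!: mult_strict_mono')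
    also have "\<dots> \<le> (w (a + b))\<^sup>2" by (rule le)
    finally show "a + b \<in> {x. t < w x}" using w[of "a + b"] by (auto intro: power2_less_imp_less)
  qed (use t u(3) v(3) in auto)
  have "(\<integral>\<^sup>+x. ennreal (u x) \<partial>lborel) + (\<integral>\<^sup>+x. ennreal (v x) \<partial>lborel)
     = (\<integral>\<^sup>+x. ennreal (min (u x) 1) \<partial>lborel) + (\<integral>\<^sup>+x. ennreal (min (v x) 1) \<partial>lborel)"
    using u v by (simp add: min_absorb1)
  also have "\<dots> = (\<integral>\<^sup>+t. (emeasure lborel {x. t < u x} + emeasure lborel {x. t < v x}) * indicator {0..<1} t \<partial>lborel)"
    unfolding nn_integral_min_1_layer_cake[OF assms(1) u(1)] nn_integral_min_1_layer_cake[OF assms(2) v(1)]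
    by (subst nn_integral_add[symmetric]) (auto simp: distrib_right)
  also have "\<dots> \<le> (\<integral>\<^sup>+t. emeasure lborel {x. t < w x} * indicator {0..<1} t \<partial>lborel)"
    by (intro nn_integral_mono) (auto simp: indicator_def level)
  also have "\<dots> = (\<integral>\<^sup>+x. ennreal (min (w x) 1) \<partial>lborel)"
    using w by (simp add: nn_integral_min_1_layer_cake)
  also have "\<dots> \<le> (\<integral>\<^sup>+x. ennreal (w x) \<partial>lborel)"
    by (intro nn_integral_mono ennreal_leI) auto
  finally show ?thesis .
qed

lemma ennreal_four_mult_le_square:
  fixes p q :: ennreal and r :: real
  assumes "p + q \<le> ennreal r" "0 \<le> r"
  shows "4 * (p * q) \<le> ennreal (r\<^sup>2)"
proof -
  have "p + q < \<top>" using assms(1) ennreal_less_top le_less_trans by blast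
  then obtain p' q' where pq: "p = ennreal p'" "q = ennreal q'" "0 \<le> p'" "0 \<le> q'"
    by (cases p; cases q) auto
  hence "p' + q' \<le> r" using assms by (simp flip: ennreal_plus)
  hence "(p' + q')\<^sup>2 \<le> r\<^sup>2" using pq by (intro power_mono) auto
  moreover have "4 * (p' * q') \<le> (p' + q')\<^sup>2" using sum_squares_bound[of p' q'] by (simp add: power2_eq_square algebra_simps)
  ultimately have "4 * (p' * q') \<le> r\<^sup>2" by linarith
  hence "ennreal (4 * (p' * q')) \<le> ennreal (r\<^sup>2)" by (rule ennreal_leI)
  also have "ennreal (4 * (p' * q')) = 4 * (p * q)" using pq by (simp add: ennreal_mult)
  finally show ?thesis .
qed

text \<open>
Dividing \<open>u\<close> and \<open>v\<close> by their suprema \<open>a\<close> and \<open>b\<close>, and \<open>w\<close> by \<open>sqrt (a * b)\<close>, reduces to the normalized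
case; the additive conclusion becomes multiplicative through \<open>4 p q \<le> (p + q)\<^sup>2\<close>. The suprema are
finite because \<open>w\<close> is bounded and neither \<open>u\<close> nor \<open>v\<close> vanishes identically.
\<close>
lemma prekopa_leindler_real:
  fixes u v w :: "real \<Rightarrow> real" and c r :: real
  assumes [measurable]: "u \<in> borel_measurable borel" "v \<in> borel_measurable borel" "w \<in> borel_measurable borel"
    and u: "\<And>x. 0 \<le> u x" and v: "\<And>x. 0 \<le> v x" and w: "\<And>x. 0 \<le> w x" "\<And>x. w x \<le> c"
    and le: "\<And>x y. u x * v y \<le> (w (x + y))\<^sup>2"
    and r: "(\<integral>\<^sup>+x. ennreal (w x) \<partial>lborel) = ennreal r" "0 \<le> r"
  shows "4 * ((\<integral>\<^sup>+x. ennreal (u x) \<partial>lborel) * (\<integral>\<^sup>+x. ennreal (v x) \<partial>lborel)) \<le> ennreal (r\<^sup>2)"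
proof (cases "(\<forall>x. u x = 0) \<or> (\<forall>y. v y = 0)")
  case True
  then show ?thesis by auto
next
  case False
  then obtain x0 y0 where x0: "0 < u x0" and y0: "0 < v y0" using u v by (metis order_le_less)
  have ub: "u x * v y \<le> c\<^sup>2" for x y
    using le[of x y] power_mono[OF w(2) w(1), of "x + y" 2] by linarith
  have bu: "bdd_above (range u)"
    using ub[of _ y0] y0 by (intro bdd_aboveI[of _ "c\<^sup>2 / v y0"]) (auto simp: field_simps)
  have bv: "bdd_above (range v)"
    using ub[of x0] x0 by (intro bdd_aboveI[of _ "c\<^sup>2 / u x0"]) (auto simp: field_simps)
  define a b where "a = Sup (range u)" and "b = Sup (range v)"
  have a': "u x \<le> a" for x unfolding a_def by (rule cSup_upper[OF rangeI bu])
  have b': "v x \<le> b" for x unfolding b_def by (rule cSup_upper[OF rangeI bv])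
  have a: "0 < a" and b: "0 < b" using x0 y0 a'[of x0] b'[of y0] by auto
  have au: "\<exists>x. t < u x / a" if "t < 1" for t
  proof -
    have "t * a < a" using that a by simp
    then obtain x where "t * a < u x" using less_cSup_iff[of "range u" "t * a"] bu by (auto simp: a_def)
    then show ?thesis using a by (auto simp: field_simps)
  qed
  have bw: "\<exists>x. t < v x / b" if "t < 1" for t
  proof -
    have "t * b < b" using that b by simp
    then obtain x where "t * b < v x" using less_cSup_iff[of "range v" "t * b"] bv by (auto simp: b_def)
    then show ?thesis using b by (auto simp: field_simps)
  qed
  define s where "s = sqrt (a * b)"
  have s: "0 < s" "s\<^sup>2 = a * b" using a b by (auto simp: s_def)
  have "(\<integral>\<^sup>+x. ennreal (u x / a) \<partial>lborel) + (\<integral>\<^sup>+x. ennreal (v x / b) \<partial>lborel) \<le> (\<integral>\<^sup>+x. ennreal (w x / s) \<partial>lborel)"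
  proof (rule prekopa_leindler_normalized)
    show "u x / a * (v y / b) \<le> (w (x + y) / s)\<^sup>2" for x y
      using le[of x y] a b by (simp add: power_divide s divide_right_mono)
  qed (simp_all add: u v w a b s au bw less_imp_le a' b')
  also have "(\<integral>\<^sup>+x. ennreal (w x / s) \<partial>lborel) = (\<integral>\<^sup>+x. ennreal (w x) * ennreal (1 / s) \<partial>lborel)"
    using w s by (intro nn_integral_cong) (simp add: ennreal_mult'[symmetric])
  also have "\<dots> = ennreal (r / s)" using r s by (simp add: nn_integral_multc ennreal_mult'[symmetric])
  finally have "4 * ((\<integral>\<^sup>+x. ennreal (u x / a) \<partial>lborel) * (\<integral>\<^sup>+x. ennreal (v x / b) \<partial>lborel)) \<le> ennreal ((r / s)\<^sup>2)"
    by (rule ennreal_four_mult_le_square) (use r s in auto)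
  hence "ennreal (a * b) * (4 * ((\<integral>\<^sup>+x. ennreal (u x / a) \<partial>lborel) * (\<integral>\<^sup>+x. ennreal (v x / b) \<partial>lborel)))
     \<le> ennreal (a * b) * ennreal ((r / s)\<^sup>2)" by (intro mult_left_mono) auto
  also have "ennreal (a * b) * ennreal ((r / s)\<^sup>2) = ennreal (r\<^sup>2)"
    using a b by (simp add: ennreal_mult'[symmetric] power_divide s)
  also have "ennreal (a * b) * (4 * ((\<integral>\<^sup>+x. ennreal (u x / a) \<partial>lborel) * (\<integral>\<^sup>+x. ennreal (v x / b) \<partial>lborel)))
    = 4 * ((ennreal a * (\<integral>\<^sup>+x. ennreal (u x / a) \<partial>lborel)) * (ennreal b * (\<integral>\<^sup>+x. ennreal (v x / b) \<partial>lborel)))"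
    using a b by (simp add: ennreal_mult mult.assoc mult.left_commute)
  also have "ennreal a * (\<integral>\<^sup>+x. ennreal (u x / a) \<partial>lborel) = (\<integral>\<^sup>+x. ennreal (u x) \<partial>lborel)"
    using a by (subst nn_integral_cmult[symmetric]) (auto simp: ennreal_mult'[symmetric])
  also have "ennreal b * (\<integral>\<^sup>+x. ennreal (v x / b) \<partial>lborel) = (\<integral>\<^sup>+x. ennreal (v x) \<partial>lborel)"
    using b by (subst nn_integral_cmult[symmetric]) (auto simp: ennreal_mult'[symmetric])
  finally show ?thesis .
qed

section \<open>A transport inequality for Gaussian product measures\<close>

abbreviation std_gaussian :: "real measure" where
  "std_gaussian \<equiv> density lborel std_normal_density"

text \<open>
The parallelogram law: this is why the cost \<open>(x - y)\<^sup>2 / 4\<close> is the one matching the midpoint form of the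
Prekopa-Leindler inequality for the standard Gaussian.
\<close>
lemma std_normal_density_mult_exp:
  "exp ((x - y)\<^sup>2 / 4) * (std_normal_density x * std_normal_density y) = (std_normal_density ((x + y) / 2))\<^sup>2"
proof -
  have "exp ((x - y)\<^sup>2 / 4) * (exp (- x\<^sup>2 / 2) * exp (- y\<^sup>2 / 2)) = exp ((x - y)\<^sup>2 / 4 + (- x\<^sup>2 / 2 + - y\<^sup>2 / 2))"
    by (simp only: exp_add)
  also have "(x - y)\<^sup>2 / 4 + (- x\<^sup>2 / 2 + - y\<^sup>2 / 2) = - ((x + y) / 2)\<^sup>2 / 2 + - ((x + y) / 2)\<^sup>2 / 2"
    by (simp add: power2_eq_square field_simps)
  also have "exp \<dots> = exp (- ((x + y) / 2)\<^sup>2 / 2) * exp (- ((x + y) / 2)\<^sup>2 / 2)" by (rule exp_add)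
  finally show ?thesis by (simp add: std_normal_density_def power2_eq_square)
qed

text \<open>
The Prekopa-Leindler inequality for \<open>u = f \<phi>\<close>, \<open>v = g \<phi>\<close> and \<open>w z = sqrt C * \<phi> (z / 2)\<close>, where \<open>\<phi>\<close> is the
standard normal density; the integral of \<open>w\<close> is \<open>2 sqrt C\<close>.
\<close>
lemma gaussian_transport_real:
  fixes f g :: "real \<Rightarrow> ennreal" and C :: real
  assumes [measurable]: "f \<in> borel_measurable borel" "g \<in> borel_measurable borel" and C: "0 \<le> C"
    and le: "\<And>x y. f x * g y \<le> ennreal (C * exp ((x - y)\<^sup>2 / 4))"
  shows "(\<integral>\<^sup>+x. f x \<partial>std_gaussian) * (\<integral>\<^sup>+x. g x \<partial>std_gaussian) \<le> ennreal C"
proof (cases "(\<forall>x. f x = 0) \<or> (\<forall>y. g y = 0)")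
  case True
  then show ?thesis by auto
next
  case False
  then obtain x0 y0 where x0: "f x0 \<noteq> 0" and y0: "g y0 \<noteq> 0" by auto
  have "f x \<noteq> \<top>" for x using le[of x y0] y0 by (auto simp: ennreal_top_mult top_unique)
  then have f: "f x = ennreal (enn2real (f x))" for x by (simp add: less_top)
  have "g y \<noteq> \<top>" for y using le[of x0 y] x0 by (auto simp: ennreal_mult_top top_unique)
  then have g: "g x = ennreal (enn2real (g x))" for x by (simp add: less_top)
  define w where "w = (\<lambda>z. sqrt C * std_normal_density (z / 2))"
  have le': "enn2real (f x) * enn2real (g y) \<le> C * exp ((x - y)\<^sup>2 / 4)" for x y
  proof -
    have "ennreal (enn2real (f x) * enn2real (g y)) \<le> ennreal (C * exp ((x - y)\<^sup>2 / 4))"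
      using le[of x y] by (simp add: ennreal_mult f[symmetric] g[symmetric])
    then show ?thesis using C by (simp add: ennreal_le_iff)
  qed
  have "(\<integral>\<^sup>+z. ennreal (std_normal_density z) \<partial>lborel) = 1"
    by (simp add: nn_integral_eq_integral)
  hence "(\<integral>\<^sup>+z. ennreal (std_normal_density (z / 2)) \<partial>lborel) = 2"
    by (subst nn_integral_real_affine[where c = 2 and t = 0]) auto
  hence w: "(\<integral>\<^sup>+z. ennreal (w z) \<partial>lborel) = ennreal (sqrt C * 2)"
    using C by (simp add: w_def ennreal_mult' nn_integral_cmult)
  have "4 * ((\<integral>\<^sup>+x. ennreal (enn2real (f x) * std_normal_density x) \<partial>lborel) *
      (\<integral>\<^sup>+x. ennreal (enn2real (g x) * std_normal_density x) \<partial>lborel)) \<le> ennreal ((sqrt C * 2)\<^sup>2)"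
  proof (rule prekopa_leindler_real[where w = w])
    fix x y
    have "enn2real (f x) * std_normal_density x * (enn2real (g y) * std_normal_density y)
      = enn2real (f x) * enn2real (g y) * (std_normal_density x * std_normal_density y)" by simp
    also have "\<dots> \<le> C * exp ((x - y)\<^sup>2 / 4) * (std_normal_density x * std_normal_density y)"
      by (intro mult_right_mono le') auto
    also have "\<dots> = C * (std_normal_density ((x + y) / 2))\<^sup>2"
      by (simp flip: std_normal_density_mult_exp)
    finally show "enn2real (f x) * std_normal_density x * (enn2real (g y) * std_normal_density y) \<le> (w (x + y))\<^sup>2"
      using C by (simp add: w_def power_mult_distrib)
  next
    show "w x \<le> sqrt C * (1 / sqrt (2 * pi))" for x
      unfolding w_def std_normal_density_def using C by (intro mult_left_mono) (auto simp: divide_right_mono)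
  qed (use C w in \<open>auto simp: w_def\<close>)
  also have "ennreal ((sqrt C * 2)\<^sup>2) = 4 * ennreal C" using C by (simp add: power_mult_distrib ennreal_mult' mult.commute)
  finally have *: "(\<integral>\<^sup>+x. ennreal (enn2real (f x) * std_normal_density x) \<partial>lborel) *
      (\<integral>\<^sup>+x. ennreal (enn2real (g x) * std_normal_density x) \<partial>lborel) \<le> ennreal C"
    using ennreal_mult_le_mult_iff[of 4] by simp
  have "(\<integral>\<^sup>+x. f x \<partial>std_gaussian) = (\<integral>\<^sup>+x. ennreal (enn2real (f x) * std_normal_density x) \<partial>lborel)"
    by (subst nn_integral_density) (auto intro!: nn_integral_cong simp: ennreal_mult f[symmetric] mult.commute[of "f _"])
  moreover have "(\<integral>\<^sup>+x. g x \<partial>std_gaussian) = (\<integral>\<^sup>+x. ennreal (enn2real (g x) * std_normal_density x) \<partial>lborel)"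
    by (subst nn_integral_density) (auto intro!: nn_integral_cong simp: ennreal_mult g[symmetric] mult.commute[of "g _"])
  ultimately show ?thesis using * by simp
qed

interpretation std_gaussian: prob_space std_gaussian
  by (rule prob_space_normal_density) simp

interpretation std_gaussian_product: product_prob_space "\<lambda>_. std_gaussian" E for E
  by unfold_locales

text \<open>
Tensorization: integrating out one coordinate of \<open>f\<close> and of \<open>g\<close> by the one-dimensional case gives
two functions of the remaining coordinates that satisfy the same hypothesis. The constant \<open>C\<close> in the
one-dimensional case absorbs the cost of the remaining coordinates.
\<close>
lemma gaussian_transport:
  fixes f g :: "('e \<Rightarrow> real) \<Rightarrow> ennreal" and C :: real
  assumes "finite E" and "0 \<le> C"
    and "f \<in> borel_measurable (\<Pi>\<^sub>M e\<in>E. std_gaussian)" "g \<in> borel_measurable (\<Pi>\<^sub>M e\<in>E. std_gaussian)"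
    and "\<And>x y. x \<in> extensional E \<Longrightarrow> y \<in> extensional E \<Longrightarrow>
          f x * g y \<le> ennreal (C * exp (\<Sum>e\<in>E. (x e - y e)\<^sup>2 / 4))"
  shows "(\<integral>\<^sup>+x. f x \<partial>(\<Pi>\<^sub>M e\<in>E. std_gaussian)) * (\<integral>\<^sup>+x. g x \<partial>(\<Pi>\<^sub>M e\<in>E. std_gaussian)) \<le> ennreal C"
  using assms
proof (induction E arbitrary: f g rule: finite_induct)
  case empty
  then show ?case by (simp add: PiM_empty nn_integral_count_space_finite)
next
  case (insert e E)
  note [measurable] = insert.prems(2,3)
  let ?P = "\<lambda>E. \<Pi>\<^sub>M e\<in>E. std_gaussian"
  define F G where "F x = (\<integral>\<^sup>+s. f (x(e := s)) \<partial>std_gaussian)" and "G x = (\<integral>\<^sup>+s. g (x(e := s)) \<partial>std_gaussian)" for x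
  have upd [measurable]: "(\<lambda>(x, s). x(e := s)) \<in> measurable (?P E \<Otimes>\<^sub>M std_gaussian) (?P (insert e E))"
    by (rule measurable_add_dim)
  have F [measurable]: "F \<in> borel_measurable (?P E)" unfolding F_def
    using measurable_compose[OF upd insert.prems(2)] by (intro std_gaussian.borel_measurable_nn_integral) (simp add: case_prod_beta)
  have G [measurable]: "G \<in> borel_measurable (?P E)" unfolding G_def
    using measurable_compose[OF upd insert.prems(3)] by (intro std_gaussian.borel_measurable_nn_integral) (simp add: case_prod_beta)
  have slice: "(\<lambda>s. x(e := s)) \<in> measurable borel (?P (insert e E))" if "x \<in> extensional E" for x
    using that by (intro measurable_PiM_single') (auto simp: space_PiM extensional_def PiE_def)
  have "(\<integral>\<^sup>+x. F x \<partial>?P E) * (\<integral>\<^sup>+x. G x \<partial>?P E) \<le> ennreal C"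
  proof (rule insert.IH)
    fix x y :: "'e \<Rightarrow> real" assume x: "x \<in> extensional E" and y: "y \<in> extensional E"
    have "F x * G y \<le> ennreal (C * exp (\<Sum>e\<in>E. (x e - y e)\<^sup>2 / 4))"
      unfolding F_def G_def
    proof (rule gaussian_transport_real)
      show "(\<lambda>s. f (x(e := s))) \<in> borel_measurable borel"
        by (rule measurable_compose[OF slice[OF x] insert.prems(2)])
      show "(\<lambda>s. g (y(e := s))) \<in> borel_measurable borel"
        by (rule measurable_compose[OF slice[OF y] insert.prems(3)])
      fix s t :: real
      have "f (x(e := s)) * g (y(e := t)) \<le> ennreal (C * exp (\<Sum>i\<in>insert e E. ((x(e := s)) i - (y(e := t)) i)\<^sup>2 / 4))"
        using x y by (intro insert.prems(4)) (auto simp: extensional_def)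
      also have "(\<Sum>i\<in>insert e E. ((x(e := s)) i - (y(e := t)) i)\<^sup>2 / 4)
         = (s - t)\<^sup>2 / 4 + (\<Sum>i\<in>E. ((x(e := s)) i - (y(e := t)) i)\<^sup>2 / 4)"
        using insert.hyps by simp
      also have "(\<Sum>i\<in>E. ((x(e := s)) i - (y(e := t)) i)\<^sup>2 / 4) = (\<Sum>i\<in>E. (x i - y i)\<^sup>2 / 4)"
        using insert.hyps by (intro sum.cong) auto
      finally show "f (x(e := s)) * g (y(e := t)) \<le> ennreal (C * exp (\<Sum>e\<in>E. (x e - y e)\<^sup>2 / 4) * exp ((s - t)\<^sup>2 / 4))"
        by (simp add: exp_add mult_ac del: fun_upd_apply)
    qed (use insert.prems in simp)
    then show "F x * G y \<le> ennreal (C * exp (\<Sum>e\<in>E. (x e - y e)\<^sup>2 / 4))" .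
  qed (use insert.prems in auto)
  then show ?case unfolding F_def G_def
    using insert.hyps by (simp add: std_gaussian_product.product_nn_integral_insert)
qed

lemma nn_integral_exp_std_gaussian:
  "(\<integral>\<^sup>+x. ennreal (exp (a * x)) \<partial>std_gaussian) = ennreal (exp (a\<^sup>2 / 2))"
proof -
  have *: "std_normal_density x * exp (a * x) = exp (a\<^sup>2 / 2) * normal_density a 1 x" for x
    by (simp add: normal_density_def mult_exp_exp power2_eq_square field_simps)
  have "(\<integral>\<^sup>+x. ennreal (exp (a * x)) \<partial>std_gaussian) = (\<integral>\<^sup>+x. ennreal (exp (a\<^sup>2 / 2)) * ennreal (normal_density a 1 x) \<partial>lborel)"
    by (simp add: nn_integral_density ennreal_mult'[symmetric] *)
  also have "\<dots> = ennreal (exp (a\<^sup>2 / 2)) * 1"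
    by (subst nn_integral_cmult) (auto simp: nn_integral_eq_integral)
  finally show ?thesis by simp
qed

lemma nn_integral_exp_square_std_gaussian:
  assumes "c < 1 / 2"
  shows "(\<integral>\<^sup>+x. ennreal (exp (c * x\<^sup>2)) \<partial>std_gaussian) = ennreal (1 / sqrt (1 - 2 * c))"
proof -
  define s where "s = 1 / sqrt (1 - 2 * c)"
  have s: "0 < s" "s\<^sup>2 = 1 / (1 - 2 * c)" using assms by (auto simp: s_def power_divide)
  have *: "std_normal_density x * exp (c * x\<^sup>2) = s * normal_density 0 s x" for x
  proof -
    have "s * normal_density 0 s x = s / sqrt (2 * pi * s\<^sup>2) * exp (- x\<^sup>2 / (2 * s\<^sup>2))"
      by (simp add: normal_density_def)
    also have "- x\<^sup>2 / (2 * s\<^sup>2) = - x\<^sup>2 / 2 + c * x\<^sup>2" using assms by (simp add: s(2) field_simps)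
    also have "sqrt (2 * pi * s\<^sup>2) = sqrt (2 * pi) * s" using s(1) by (simp add: real_sqrt_mult)
    finally show ?thesis using s(1) by (simp add: std_normal_density_def mult_exp_exp)
  qed
  have "(\<integral>\<^sup>+x. ennreal (exp (c * x\<^sup>2)) \<partial>std_gaussian) = (\<integral>\<^sup>+x. ennreal s * ennreal (normal_density 0 s x) \<partial>lborel)"
    using s by (simp add: nn_integral_density ennreal_mult'[symmetric] *)
  also have "\<dots> = ennreal s * 1"
    using s by (subst nn_integral_cmult) (auto simp: nn_integral_eq_integral)
  finally show ?thesis by (simp add: s_def)
qed

text \<open>
Read from left to right this is the Gaussian moment generating function; read from right to left it
linearizes the exponential of a sum of squares.
\<close>
lemma nn_integral_exp_linear_gaussian:
  assumes "finite E"
  shows "(\<integral>\<^sup>+x. ennreal (exp (\<Sum>e\<in>E. a e * x e)) \<partial>(\<Pi>\<^sub>M e\<in>E. std_gaussian)) = ennreal (exp (\<Sum>e\<in>E. (a e)\<^sup>2 / 2))"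
proof -
  have "(\<integral>\<^sup>+x. ennreal (exp (\<Sum>e\<in>E. a e * x e)) \<partial>(\<Pi>\<^sub>M e\<in>E. std_gaussian))
    = (\<integral>\<^sup>+x. (\<Prod>e\<in>E. ennreal (exp (a e * x e))) \<partial>(\<Pi>\<^sub>M e\<in>E. std_gaussian))"
    using assms by (simp add: exp_sum prod_ennreal)
  also have "\<dots> = (\<Prod>e\<in>E. \<integral>\<^sup>+x. ennreal (exp (a e * x)) \<partial>std_gaussian)"
    using assms by (intro std_gaussian_product.product_nn_integral_prod) auto
  also have "\<dots> = ennreal (exp (\<Sum>e\<in>E. (a e)\<^sup>2 / 2))"
    using assms by (simp add: nn_integral_exp_std_gaussian exp_sum prod_ennreal)
  finally show ?thesis .
qed

section \<open>Gaussian Gibbs measures with a bounded tilted second moment\<close>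

lemma exp_ge_tangent: "exp c * (1 + t - c) \<le> exp (t::real)"
proof -
  have "exp c * (1 + (t - c)) \<le> exp c * exp (t - c)" by (intro mult_left_mono exp_ge_add_one_self) auto
  then show ?thesis by (simp flip: exp_add add: add_diff_eq)
qed

lemma mult_le_half_sum_squares: "u * v \<le> (u\<^sup>2 + v\<^sup>2) / 2" for u v :: real
  using sum_squares_bound[of u v] by simp

text \<open>
A finite family of energies that are linear in a standard Gaussian vector. The equality of all
variances reflects the absence of an external field and makes \<open>exp (energy \<sigma>)\<close> have the same mean
for every \<open>\<sigma>\<close>.
\<close>
locale gaussian_spin_system =
  fixes S :: "'s set" and E :: "'e set" and a :: "'s \<Rightarrow> 'e \<Rightarrow> real" and \<kappa> :: real
  assumes finite_S: "finite S" and S_nonempty: "S \<noteq> {}" and finite_E: "finite E"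
    and variance: "\<sigma> \<in> S \<Longrightarrow> (\<Sum>e\<in>E. (a \<sigma> e)\<^sup>2) = \<kappa>"
begin

definition energy :: "'s \<Rightarrow> ('e \<Rightarrow> real) \<Rightarrow> real" where
  "energy \<sigma> x = (\<Sum>e\<in>E. a \<sigma> e * x e)"

definition Z :: "('e \<Rightarrow> real) \<Rightarrow> real" where
  "Z x = (\<Sum>\<sigma>\<in>S. exp (energy \<sigma> x))"

text \<open>
The Gaussian expectation of \<open>Z\<close>.
\<close>
definition mean_Z :: real where
  "mean_Z = real (card S) * exp (\<kappa> / 2)"

definition cov :: "'s \<Rightarrow> 's \<Rightarrow> real" where
  "cov \<sigma> \<tau> = (\<Sum>e\<in>E. a \<sigma> e * a \<tau> e)"

definition pair_average :: "('s \<Rightarrow> 's \<Rightarrow> real) \<Rightarrow> ('e \<Rightarrow> real) \<Rightarrow> real" where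
  "pair_average F x = (\<Sum>\<sigma>\<in>S. \<Sum>\<tau>\<in>S. F \<sigma> \<tau> * exp (energy \<sigma> x + energy \<tau> x)) / (Z x)\<^sup>2"

abbreviation gaussian :: "('e \<Rightarrow> real) measure" where
  "gaussian \<equiv> \<Pi>\<^sub>M e\<in>E. std_gaussian"

lemma energy_measurable [measurable]: "energy \<sigma> \<in> borel_measurable gaussian"
  unfolding energy_def by measurable

lemma Z_measurable [measurable]: "Z \<in> borel_measurable gaussian"
  unfolding Z_def by measurable

lemma pair_average_measurable [measurable]: "pair_average F \<in> borel_measurable gaussian"
  unfolding pair_average_def by measurable

lemma Z_pos: "0 < Z x"
  unfolding Z_def using finite_S S_nonempty by (intro sum_pos) auto

lemma mean_Z_pos: "0 < mean_Z"
  unfolding mean_Z_def using finite_S S_nonempty by (simp add: card_gt_0_iff)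

lemma mean_Z_square: "mean_Z\<^sup>2 = (real (card S))\<^sup>2 * exp \<kappa>"
proof -
  have "exp \<kappa> = exp (\<kappa> / 2) * exp (\<kappa> / 2)" by (simp add: mult_exp_exp)
  then show ?thesis by (simp add: mean_Z_def power_mult_distrib power2_eq_square)
qed

lemma Z_square: "(Z x)\<^sup>2 = (\<Sum>\<sigma>\<in>S. \<Sum>\<tau>\<in>S. exp (energy \<sigma> x + energy \<tau> x))"
  by (simp add: Z_def power2_eq_square sum_product exp_add)

lemma Z_square_pair_average:
  "(Z x)\<^sup>2 * pair_average F x = (\<Sum>\<sigma>\<in>S. \<Sum>\<tau>\<in>S. F \<sigma> \<tau> * exp (energy \<sigma> x + energy \<tau> x))"
  using Z_pos[of x] by (simp add: pair_average_def)

lemma pair_average_mono: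
  assumes "\<And>\<sigma> \<tau>. \<sigma> \<in> S \<Longrightarrow> \<tau> \<in> S \<Longrightarrow> F \<sigma> \<tau> \<le> G \<sigma> \<tau>"
  shows "pair_average F x \<le> pair_average G x"
  unfolding pair_average_def by (intro divide_right_mono sum_mono mult_right_mono assms) auto

lemma pair_average_nonneg:
  assumes "\<And>\<sigma> \<tau>. \<sigma> \<in> S \<Longrightarrow> \<tau> \<in> S \<Longrightarrow> 0 \<le> F \<sigma> \<tau>"
  shows "0 \<le> pair_average F x"
  unfolding pair_average_def by (intro divide_nonneg_nonneg sum_nonneg mult_nonneg_nonneg assms) auto

lemma pair_average_const: "pair_average (\<lambda>_ _. c) x = c"
proof -
  have "pair_average (\<lambda>_ _. c) x = c * (Z x)\<^sup>2 / (Z x)\<^sup>2"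
    by (simp only: pair_average_def Z_square sum_distrib_left)
  then show ?thesis using Z_pos[of x] by simp
qed

text \<open>
Multiplication by \<open>Z\<^sup>2\<close> cancels the normalization of the two-replica Gibbs measure; what is left
are exponentials of Gaussian variables of variance \<open>2 \<kappa> + 2 cov \<sigma> \<tau>\<close>.
\<close>
lemma second_moment:
  assumes "\<And>\<sigma> \<tau>. \<sigma> \<in> S \<Longrightarrow> \<tau> \<in> S \<Longrightarrow> 0 \<le> F \<sigma> \<tau>"
  shows "(\<integral>\<^sup>+x. ennreal ((Z x / mean_Z)\<^sup>2 * pair_average F x) \<partial>gaussian)
    = ennreal ((\<Sum>\<sigma>\<in>S. \<Sum>\<tau>\<in>S. F \<sigma> \<tau> * exp (cov \<sigma> \<tau>)) / (real (card S))\<^sup>2)"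
proof -
  have pair: "(\<integral>\<^sup>+x. ennreal (exp (energy \<sigma> x + energy \<tau> x)) \<partial>gaussian) = ennreal (exp (\<kappa> + cov \<sigma> \<tau>))"
    if "\<sigma> \<in> S" "\<tau> \<in> S" for \<sigma> \<tau>
  proof -
    have "energy \<sigma> x + energy \<tau> x = (\<Sum>e\<in>E. (a \<sigma> e + a \<tau> e) * x e)" for x
      by (simp add: energy_def sum.distrib distrib_right)
    hence "(\<integral>\<^sup>+x. ennreal (exp (energy \<sigma> x + energy \<tau> x)) \<partial>gaussian)
       = ennreal (exp (\<Sum>e\<in>E. (a \<sigma> e + a \<tau> e)\<^sup>2 / 2))"
      using nn_integral_exp_linear_gaussian[OF finite_E, of "\<lambda>e. a \<sigma> e + a \<tau> e"] by simp
    also have "(\<Sum>e\<in>E. (a \<sigma> e + a \<tau> e)\<^sup>2 / 2) = ((\<Sum>e\<in>E. (a \<sigma> e)\<^sup>2) + (\<Sum>e\<in>E. (a \<tau> e)\<^sup>2)) / 2 + cov \<sigma> \<tau>"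
      by (simp add: cov_def power2_sum sum.distrib sum_divide_distrib add_divide_distrib mult.assoc)
    finally show ?thesis using that by (simp add: variance)
  qed
  have "(\<integral>\<^sup>+x. ennreal ((Z x / mean_Z)\<^sup>2 * pair_average F x) \<partial>gaussian)
    = (\<integral>\<^sup>+x. (\<Sum>\<sigma>\<in>S. \<Sum>\<tau>\<in>S. ennreal (F \<sigma> \<tau> / mean_Z\<^sup>2) * ennreal (exp (energy \<sigma> x + energy \<tau> x))) \<partial>gaussian)"
  proof (rule nn_integral_cong)
    fix x
    have "(Z x / mean_Z)\<^sup>2 * pair_average F x = (\<Sum>\<sigma>\<in>S. \<Sum>\<tau>\<in>S. F \<sigma> \<tau> / mean_Z\<^sup>2 * exp (energy \<sigma> x + energy \<tau> x))"
      using Z_square_pair_average[of x F] by (simp add: power_divide sum_divide_distrib)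
    then show "ennreal ((Z x / mean_Z)\<^sup>2 * pair_average F x)
      = (\<Sum>\<sigma>\<in>S. \<Sum>\<tau>\<in>S. ennreal (F \<sigma> \<tau> / mean_Z\<^sup>2) * ennreal (exp (energy \<sigma> x + energy \<tau> x)))"
      by (simp add: sum_nonneg assms flip: ennreal_mult')
  qed
  also have "\<dots> = (\<Sum>\<sigma>\<in>S. \<Sum>\<tau>\<in>S. ennreal (F \<sigma> \<tau> / mean_Z\<^sup>2) * ennreal (exp (\<kappa> + cov \<sigma> \<tau>)))"
    by (simp add: nn_integral_sum nn_integral_cmult pair)
  also have "\<dots> = ennreal (\<Sum>\<sigma>\<in>S. \<Sum>\<tau>\<in>S. F \<sigma> \<tau> / mean_Z\<^sup>2 * exp (\<kappa> + cov \<sigma> \<tau>))"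
    by (simp add: sum_nonneg assms flip: ennreal_mult')
  also have "(\<Sum>\<sigma>\<in>S. \<Sum>\<tau>\<in>S. F \<sigma> \<tau> / mean_Z\<^sup>2 * exp (\<kappa> + cov \<sigma> \<tau>))
     = (\<Sum>\<sigma>\<in>S. \<Sum>\<tau>\<in>S. F \<sigma> \<tau> * exp (cov \<sigma> \<tau>)) / (real (card S))\<^sup>2"
    by (simp add: mean_Z_square sum_divide_distrib exp_add)
  finally show ?thesis .
qed

text \<open>
Convexity of \<open>log Z\<close>: it lies above its tangent plane at \<open>y\<close>, whose gradient \<open>G\<close> is the Gibbs average
of \<open>a\<close> and has squared length \<open>pair_average cov y\<close>. The scalar product of the gradient with \<open>x - y\<close>
is split so that the quadratic term carries exactly the weight \<open>1 / 4\<close> of \<open>gaussian_transport\<close>.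
\<close>
lemma partition_function_ratio_le:
  "(Z y / Z x)\<^sup>2 \<le> exp (\<Sum>e\<in>E. (x e - y e)\<^sup>2 / 4) * exp (4 * pair_average cov y)"
proof -
  define p where "p \<sigma> = exp (energy \<sigma> y) / Z y" for \<sigma>
  define G where "G e = (\<Sum>\<sigma>\<in>S. p \<sigma> * a \<sigma> e)" for e
  define t where "t \<sigma> = energy \<sigma> x - energy \<sigma> y" for \<sigma>
  define c where "c = (\<Sum>\<sigma>\<in>S. p \<sigma> * t \<sigma>)"
  have p1: "(\<Sum>\<sigma>\<in>S. p \<sigma>) = 1" using Z_pos[of y] by (simp add: p_def Z_def flip: sum_divide_distrib)
  have "exp c = (\<Sum>\<sigma>\<in>S. p \<sigma> * (exp c * (1 + t \<sigma> - c)))"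
  proof -
    have "(\<Sum>\<sigma>\<in>S. p \<sigma> * (k * (1 + t \<sigma> - c))) = k * ((\<Sum>\<sigma>\<in>S. p \<sigma>) + (\<Sum>\<sigma>\<in>S. p \<sigma> * t \<sigma>) - c * (\<Sum>\<sigma>\<in>S. p \<sigma>))" for k
      by (simp add: sum.distrib sum_subtractf sum_distrib_left algebra_simps)
    from this[of "exp c"] show ?thesis by (simp add: p1 c_def[symmetric])
  qed
  also have "\<dots> \<le> (\<Sum>\<sigma>\<in>S. p \<sigma> * exp (t \<sigma>))"
    using Z_pos[of y] by (intro sum_mono mult_left_mono exp_ge_tangent) (auto simp: p_def)
  also have "\<dots> = Z x / Z y"
    by (simp add: p_def t_def Z_def exp_diff sum_divide_distrib)
  \<comment> \<open>Jensen's inequality for the Gibbs measure at \<open>y\<close>, obtained from tangent lines at the mean \<open>c\<close>.\<close>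
  finally have Jensen: "exp c \<le> Z x / Z y" .
  have c: "c = (\<Sum>e\<in>E. G e * (x e - y e))"
  proof -
    have "c = (\<Sum>\<sigma>\<in>S. \<Sum>e\<in>E. p \<sigma> * a \<sigma> e * (x e - y e))"
      by (simp add: c_def t_def energy_def sum_distrib_left right_diff_distrib mult.assoc flip: sum_subtractf)
    also have "\<dots> = (\<Sum>e\<in>E. G e * (x e - y e))"
      by (subst sum.swap) (simp add: G_def sum_distrib_right)
    finally show ?thesis .
  qed
  have G: "(\<Sum>e\<in>E. (G e)\<^sup>2) = pair_average cov y"
  proof -
    have "(\<Sum>e\<in>E. (G e)\<^sup>2) = (\<Sum>e\<in>E. \<Sum>\<sigma>\<in>S. \<Sum>\<tau>\<in>S. p \<sigma> * p \<tau> * (a \<sigma> e * a \<tau> e))"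
      by (simp add: G_def power2_eq_square sum_product mult_ac)
    also have "\<dots> = (\<Sum>\<sigma>\<in>S. \<Sum>e\<in>E. \<Sum>\<tau>\<in>S. p \<sigma> * p \<tau> * (a \<sigma> e * a \<tau> e))" by (rule sum.swap)
    also have "\<dots> = (\<Sum>\<sigma>\<in>S. \<Sum>\<tau>\<in>S. \<Sum>e\<in>E. p \<sigma> * p \<tau> * (a \<sigma> e * a \<tau> e))" by (intro sum.cong refl sum.swap)
    also have "\<dots> = pair_average cov y"
      by (simp add: pair_average_def cov_def p_def exp_add power2_eq_square sum_divide_distrib sum_distrib_left sum_distrib_right mult_ac)
    finally show ?thesis .
  qed
  have "Z y / Z x \<le> exp (- c)"
  proof -
    have "inverse (Z x / Z y) \<le> inverse (exp c)" by (intro le_imp_inverse_le Jensen) auto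
    then show ?thesis by (simp add: exp_minus)
  qed
  hence "(Z y / Z x)\<^sup>2 \<le> (exp (- c))\<^sup>2" using Z_pos[of x] Z_pos[of y] by (intro power_mono) auto
  also have "\<dots> = exp (\<Sum>e\<in>E. - 2 * (G e * (x e - y e)))"
    by (simp add: c power2_eq_square mult_exp_exp sum_distrib_left sum_negf)
  also have "\<dots> \<le> exp (\<Sum>e\<in>E. (x e - y e)\<^sup>2 / 4 + 4 * (G e)\<^sup>2)"
  proof (intro iffD2[OF exp_le_cancel_iff] sum_mono)
    fix e
    \<comment> \<open>The weights \<open>4\<close> and \<open>1 / 4\<close> make the sum of the two terms a perfect square.\<close>
    have "0 \<le> (2 * G e + (x e - y e) / 2)\<^sup>2" by simp
    then show "- 2 * (G e * (x e - y e)) \<le> (x e - y e)\<^sup>2 / 4 + 4 * (G e)\<^sup>2"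
      by (simp add: power2_eq_square field_simps)
  qed
  also have "\<dots> = exp (\<Sum>e\<in>E. (x e - y e)\<^sup>2 / 4) * exp (4 * pair_average cov y)"
    by (simp add: sum.distrib exp_add G flip: sum_distrib_left)
  finally show ?thesis .
qed

end

text \<open>
The high temperature hypothesis: \<open>W\<close> dominates the covariance, and the second moment of \<open>Z\<close> stays
comparable to the square of the first even after tilting by \<open>exp (2 \<gamma> W)\<close>.
\<close>
locale high_temperature_spin_system = gaussian_spin_system S E a \<kappa>
  for S :: "'s set" and E :: "'e set" and a :: "'s \<Rightarrow> 'e \<Rightarrow> real" and \<kappa> :: real +
  fixes W :: "'s \<Rightarrow> 's \<Rightarrow> real" and b \<gamma> B :: real
  assumes W_nonneg: "\<sigma> \<in> S \<Longrightarrow> \<tau> \<in> S \<Longrightarrow> 0 \<le> W \<sigma> \<tau>"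
    and cov_le: "\<sigma> \<in> S \<Longrightarrow> \<tau> \<in> S \<Longrightarrow> cov \<sigma> \<tau> \<le> b * W \<sigma> \<tau>"
    and b_nonneg: "0 \<le> b" and \<gamma>_pos: "0 < \<gamma>"
    and exp_moment: "(\<Sum>\<sigma>\<in>S. \<Sum>\<tau>\<in>S. exp (cov \<sigma> \<tau> + 2 * \<gamma> * W \<sigma> \<tau>)) \<le> B * (real (card S))\<^sup>2"
begin

lemma second_moment_ge_1: "1 \<le> (\<integral>\<^sup>+x. ennreal ((Z x / mean_Z)\<^sup>2) \<partial>gaussian)"
proof -
  have "0 \<le> (\<Sum>e\<in>E. (\<Sum>\<sigma>\<in>S. a \<sigma> e)\<^sup>2)" by (intro sum_nonneg) auto
  also have "\<dots> = (\<Sum>e\<in>E. \<Sum>\<sigma>\<in>S. \<Sum>\<tau>\<in>S. a \<sigma> e * a \<tau> e)"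
    by (simp add: power2_eq_square sum_product)
  also have "\<dots> = (\<Sum>\<sigma>\<in>S. \<Sum>e\<in>E. \<Sum>\<tau>\<in>S. a \<sigma> e * a \<tau> e)" by (rule sum.swap)
  also have "\<dots> = (\<Sum>\<sigma>\<in>S. \<Sum>\<tau>\<in>S. cov \<sigma> \<tau>)" unfolding cov_def by (intro sum.cong refl sum.swap)
  \<comment> \<open>The covariances sum to a squared length, so the mean of \<open>exp cov\<close> is at least \<open>1\<close>.\<close>
  finally have "(real (card S))\<^sup>2 \<le> (\<Sum>\<sigma>\<in>S. \<Sum>\<tau>\<in>S. 1 + cov \<sigma> \<tau>)"
    by (simp add: sum.distrib power2_eq_square)
  also have "\<dots> \<le> (\<Sum>\<sigma>\<in>S. \<Sum>\<tau>\<in>S. exp (cov \<sigma> \<tau>))" by (intro sum_mono exp_ge_add_one_self)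
  finally have "1 \<le> (\<Sum>\<sigma>\<in>S. \<Sum>\<tau>\<in>S. exp (cov \<sigma> \<tau>)) / (real (card S))\<^sup>2"
    using finite_S S_nonempty by (simp add: le_divide_eq_1 card_gt_0_iff)
  then show ?thesis using second_moment[of "\<lambda>_ _. 1"] by (simp add: pair_average_const)
qed

text \<open>
Four times the bound on the mean of \<open>b * W\<close> under the tilt by \<open>(Z / mean_Z)\<^sup>2\<close>.
\<close>
definition tilt :: real where "tilt = 2 * b * B / \<gamma>"

lemma B_nonneg: "0 \<le> B"
proof -
  have "0 \<le> B * (real (card S))\<^sup>2"
    using order_trans[OF _ exp_moment, of 0] by (simp add: sum_nonneg)
  then show ?thesis using finite_S S_nonempty by (simp add: zero_le_mult_iff card_gt_0_iff)
qed

lemma tilt_nonneg: "0 \<le> tilt"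
  using B_nonneg b_nonneg \<gamma>_pos by (simp add: tilt_def)

text \<open>
The exponential moment controls the first moment because \<open>t \<le> exp t\<close>.
\<close>
lemma tilted_overlap_moment_le:
  "(\<integral>\<^sup>+x. ennreal ((Z x / mean_Z)\<^sup>2 * pair_average (\<lambda>\<sigma> \<tau>. b * W \<sigma> \<tau>) x) \<partial>gaussian) \<le> ennreal (tilt / 4)"
proof -
  have "(\<Sum>\<sigma>\<in>S. \<Sum>\<tau>\<in>S. b * W \<sigma> \<tau> * exp (cov \<sigma> \<tau>))
     \<le> (\<Sum>\<sigma>\<in>S. \<Sum>\<tau>\<in>S. b / (2 * \<gamma>) * exp (cov \<sigma> \<tau> + 2 * \<gamma> * W \<sigma> \<tau>))"
  proof (intro sum_mono)
    fix \<sigma> \<tau> assume "\<sigma> \<in> S" "\<tau> \<in> S"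
    have "2 * \<gamma> * W \<sigma> \<tau> \<le> exp (2 * \<gamma> * W \<sigma> \<tau>)" using exp_ge_add_one_self[of "2 * \<gamma> * W \<sigma> \<tau>"] by linarith
    hence "b / (2 * \<gamma>) * (2 * \<gamma> * W \<sigma> \<tau>) * exp (cov \<sigma> \<tau>) \<le> b / (2 * \<gamma>) * exp (2 * \<gamma> * W \<sigma> \<tau>) * exp (cov \<sigma> \<tau>)"
      using b_nonneg \<gamma>_pos by (intro mult_right_mono mult_left_mono) auto
    then show "b * W \<sigma> \<tau> * exp (cov \<sigma> \<tau>) \<le> b / (2 * \<gamma>) * exp (cov \<sigma> \<tau> + 2 * \<gamma> * W \<sigma> \<tau>)"
      using \<gamma>_pos by (simp add: exp_add mult_ac)
  qed
  also have "\<dots> \<le> b / (2 * \<gamma>) * (B * (real (card S))\<^sup>2)"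
    using b_nonneg \<gamma>_pos exp_moment by (simp only: flip: sum_distrib_left) (intro mult_left_mono, auto)
  finally have "(\<Sum>\<sigma>\<in>S. \<Sum>\<tau>\<in>S. b * W \<sigma> \<tau> * exp (cov \<sigma> \<tau>)) / (real (card S))\<^sup>2 \<le> tilt / 4"
    using finite_S S_nonempty by (simp add: tilt_def divide_le_eq card_gt_0_iff field_simps)
  then show ?thesis
    using b_nonneg W_nonneg by (subst second_moment) (auto intro: ennreal_leI)
qed

text \<open>
The lower tail of \<open>Z\<close>. The functions \<open>f\<close> and \<open>g\<close> satisfy the hypothesis of \<open>gaussian_transport\<close> with
\<open>C = 1\<close> by convexity of \<open>log Z\<close>, so the integral of \<open>f\<close> is at most the reciprocal of that of \<open>g\<close>. The
latter is bounded below by Jensen's inequality for the density \<open>(Z / mean_Z)\<^sup>2\<close>, used in the form of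
the tangent line to the exponential at \<open>- tilt\<close>.
\<close>
lemma inverse_second_moment_le:
  "(\<integral>\<^sup>+x. ennreal ((mean_Z / Z x)\<^sup>2) \<partial>gaussian) \<le> ennreal (exp tilt)"
proof -
  define \<Gamma> where "\<Gamma> = pair_average (\<lambda>\<sigma> \<tau>. b * W \<sigma> \<tau>)"
  have [measurable]: "\<Gamma> \<in> borel_measurable gaussian" by (simp add: \<Gamma>_def)
  have \<Gamma>_nonneg: "0 \<le> \<Gamma> x" for x
    unfolding \<Gamma>_def using b_nonneg W_nonneg by (intro pair_average_nonneg) auto
  define f g where "f x = ennreal ((mean_Z / Z x)\<^sup>2)"
    and "g x = ennreal ((Z x / mean_Z)\<^sup>2 * exp (- (4 * \<Gamma> x)))" for x
  have [measurable]: "f \<in> borel_measurable gaussian" "g \<in> borel_measurable gaussian"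
    unfolding f_def g_def by measurable
  have "(\<integral>\<^sup>+x. f x \<partial>gaussian) * (\<integral>\<^sup>+x. g x \<partial>gaussian) \<le> ennreal 1"
  proof (rule gaussian_transport[OF finite_E])
    fix x y
    have "(mean_Z / Z x)\<^sup>2 * ((Z y / mean_Z)\<^sup>2 * exp (- (4 * \<Gamma> y))) = (Z y / Z x)\<^sup>2 * exp (- (4 * \<Gamma> y))"
      using mean_Z_pos by (simp add: power_divide)
    also have "\<dots> \<le> (exp (\<Sum>e\<in>E. (x e - y e)\<^sup>2 / 4) * exp (4 * pair_average cov y)) * exp (- (4 * \<Gamma> y))"
      by (intro mult_right_mono partition_function_ratio_le) auto
    also have "\<dots> \<le> (exp (\<Sum>e\<in>E. (x e - y e)\<^sup>2 / 4) * exp (4 * \<Gamma> y)) * exp (- (4 * \<Gamma> y))"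
      unfolding \<Gamma>_def by (intro mult_right_mono mult_left_mono iffD2[OF exp_le_cancel_iff] pair_average_mono cov_le) auto
    finally have "(mean_Z / Z x)\<^sup>2 * ((Z y / mean_Z)\<^sup>2 * exp (- (4 * \<Gamma> y))) \<le> 1 * exp (\<Sum>e\<in>E. (x e - y e)\<^sup>2 / 4)"
      by (simp add: mult.assoc mult_exp_exp)
    then show "f x * g y \<le> ennreal (1 * exp (\<Sum>e\<in>E. (x e - y e)\<^sup>2 / 4))"
      unfolding f_def g_def by (subst ennreal_mult[symmetric]) (auto intro: ennreal_leI)
  qed auto
  moreover have "ennreal (exp (- tilt)) \<le> (\<integral>\<^sup>+x. g x \<partial>gaussian)"
  proof -
    have "ennreal (exp (- tilt)) + ennreal (exp (- tilt) * tilt) = ennreal (exp (- tilt) * (1 + tilt)) * 1"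
      using tilt_nonneg by (simp add: distrib_left flip: ennreal_plus)
    also have "\<dots> \<le> ennreal (exp (- tilt) * (1 + tilt)) * (\<integral>\<^sup>+x. ennreal ((Z x / mean_Z)\<^sup>2) \<partial>gaussian)"
      by (intro mult_left_mono second_moment_ge_1) auto
    also have "\<dots> = (\<integral>\<^sup>+x. ennreal (exp (- tilt) * (1 + tilt) * (Z x / mean_Z)\<^sup>2) \<partial>gaussian)"
      using tilt_nonneg by (simp add: nn_integral_cmult[symmetric] ennreal_mult)
    also have "\<dots> \<le> (\<integral>\<^sup>+x. g x + ennreal (4 * exp (- tilt)) * ennreal ((Z x / mean_Z)\<^sup>2 * \<Gamma> x) \<partial>gaussian)"
    proof (rule nn_integral_mono)
      fix x
      \<comment> \<open>The negative part of the tangent line is moved to the other side, so that all integrands are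
          nonnegative.\<close>
      have "exp (- tilt) * (1 + - (4 * \<Gamma> x) - - tilt) * (Z x / mean_Z)\<^sup>2 \<le> exp (- (4 * \<Gamma> x)) * (Z x / mean_Z)\<^sup>2"
        by (intro mult_right_mono exp_ge_tangent) auto
      hence "exp (- tilt) * (1 + tilt) * (Z x / mean_Z)\<^sup>2
         \<le> (Z x / mean_Z)\<^sup>2 * exp (- (4 * \<Gamma> x)) + 4 * exp (- tilt) * ((Z x / mean_Z)\<^sup>2 * \<Gamma> x)"
        by (simp add: algebra_simps)
      then show "ennreal (exp (- tilt) * (1 + tilt) * (Z x / mean_Z)\<^sup>2)
         \<le> g x + ennreal (4 * exp (- tilt)) * ennreal ((Z x / mean_Z)\<^sup>2 * \<Gamma> x)"
        unfolding g_def using \<Gamma>_nonneg[of x]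
        by (simp add: ennreal_leI flip: ennreal_mult ennreal_plus)
    qed
    also have "\<dots> = (\<integral>\<^sup>+x. g x \<partial>gaussian) + ennreal (4 * exp (- tilt)) * (\<integral>\<^sup>+x. ennreal ((Z x / mean_Z)\<^sup>2 * \<Gamma> x) \<partial>gaussian)"
      by (simp add: nn_integral_add nn_integral_cmult)
    also have "\<dots> \<le> (\<integral>\<^sup>+x. g x \<partial>gaussian) + ennreal (4 * exp (- tilt)) * ennreal (tilt / 4)"
      unfolding \<Gamma>_def by (intro add_left_mono mult_left_mono tilted_overlap_moment_le) auto
    also have "ennreal (4 * exp (- tilt)) * ennreal (tilt / 4) = ennreal (exp (- tilt) * tilt)"
      using tilt_nonneg by (simp flip: ennreal_mult)
    finally have "ennreal (exp (- tilt) * tilt) + ennreal (exp (- tilt)) \<le> ennreal (exp (- tilt) * tilt) + (\<integral>\<^sup>+x. g x \<partial>gaussian)"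
      by (simp add: add.commute)
    then show ?thesis by (simp add: ennreal_add_left_cancel_le)
  qed
  ultimately have "(\<integral>\<^sup>+x. f x \<partial>gaussian) * ennreal (exp (- tilt)) \<le> 1"
    by (auto intro: order_trans[OF mult_left_mono])
  hence "(\<integral>\<^sup>+x. f x \<partial>gaussian) * ennreal (exp (- tilt)) * ennreal (exp tilt) \<le> 1 * ennreal (exp tilt)"
    by (intro mult_right_mono) auto
  then show ?thesis by (simp add: mult.assoc f_def mult_exp_exp flip: ennreal_mult)
qed

text \<open>
The two terms of the arithmetic-geometric mean inequality are bounded by the tilted second moment and
by the negative second moment.
\<close>
theorem exp_moment_pair_average_le:
  "(\<integral>\<^sup>+x. ennreal (pair_average (\<lambda>\<sigma> \<tau>. exp (\<gamma> * W \<sigma> \<tau>)) x) \<partial>gaussian) \<le> ennreal ((B + exp tilt) / 2)"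
proof -
  let ?F = "\<lambda>\<sigma> \<tau>. exp (2 * \<gamma> * W \<sigma> \<tau>)"
  have pointwise: "pair_average (\<lambda>\<sigma> \<tau>. exp (\<gamma> * W \<sigma> \<tau>)) x
     \<le> (1 / 2) * ((Z x / mean_Z)\<^sup>2 * pair_average ?F x) + (1 / 2) * (mean_Z / Z x)\<^sup>2" for x
  proof -
    \<comment> \<open>Arithmetic-geometric mean with the weight \<open>Z x / mean_Z\<close>, a constant under the Gibbs average.\<close>
    have "exp (\<gamma> * W \<sigma> \<tau>) \<le> (Z x / mean_Z)\<^sup>2 / 2 * ?F \<sigma> \<tau> + (mean_Z / Z x)\<^sup>2 / 2" for \<sigma> \<tau>
    proof -
      have "exp (\<gamma> * W \<sigma> \<tau>) = (Z x / mean_Z * exp (\<gamma> * W \<sigma> \<tau>)) * (mean_Z / Z x)"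
        using Z_pos[of x] mean_Z_pos by simp
      also have "\<dots> \<le> ((Z x / mean_Z * exp (\<gamma> * W \<sigma> \<tau>))\<^sup>2 + (mean_Z / Z x)\<^sup>2) / 2"
        by (rule mult_le_half_sum_squares)
      also have "(Z x / mean_Z * exp (\<gamma> * W \<sigma> \<tau>))\<^sup>2 = (Z x / mean_Z)\<^sup>2 * ?F \<sigma> \<tau>"
        by (simp only: power_mult_distrib exp_double mult.assoc)
      finally show ?thesis by (simp add: add_divide_distrib)
    qed
    hence "pair_average (\<lambda>\<sigma> \<tau>. exp (\<gamma> * W \<sigma> \<tau>)) x
       \<le> pair_average (\<lambda>\<sigma> \<tau>. (Z x / mean_Z)\<^sup>2 / 2 * ?F \<sigma> \<tau> + (mean_Z / Z x)\<^sup>2 / 2) x"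
      by (intro pair_average_mono)
    also have "\<dots> = (Z x / mean_Z)\<^sup>2 / 2 * pair_average ?F x + pair_average (\<lambda>_ _. (mean_Z / Z x)\<^sup>2 / 2) x"
      by (simp add: pair_average_def distrib_right sum.distrib add_divide_distrib sum_distrib_left mult.assoc)
    finally show ?thesis by (simp add: pair_average_const)
  qed
  have zero_le_half: "(0::real) \<le> 1 / 2" by simp
  have "(\<integral>\<^sup>+x. ennreal (pair_average (\<lambda>\<sigma> \<tau>. exp (\<gamma> * W \<sigma> \<tau>)) x) \<partial>gaussian)
    \<le> (\<integral>\<^sup>+x. ennreal (1 / 2) * ennreal ((Z x / mean_Z)\<^sup>2 * pair_average ?F x) + ennreal (1 / 2) * ennreal ((mean_Z / Z x)\<^sup>2) \<partial>gaussian)"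
  proof (rule nn_integral_mono)
    fix x
    have "0 \<le> pair_average ?F x" by (intro pair_average_nonneg) auto
    then show "ennreal (pair_average (\<lambda>\<sigma> \<tau>. exp (\<gamma> * W \<sigma> \<tau>)) x)
       \<le> ennreal (1 / 2) * ennreal ((Z x / mean_Z)\<^sup>2 * pair_average ?F x) + ennreal (1 / 2) * ennreal ((mean_Z / Z x)\<^sup>2)"
      using ennreal_leI[OF pointwise[of x]]
      by (simp only: ennreal_plus ennreal_mult' mult_nonneg_nonneg zero_le_power2 zero_le_half)
  qed
  also have "\<dots> = ennreal (1 / 2) * (\<integral>\<^sup>+x. ennreal ((Z x / mean_Z)\<^sup>2 * pair_average ?F x) \<partial>gaussian)
      + ennreal (1 / 2) * (\<integral>\<^sup>+x. ennreal ((mean_Z / Z x)\<^sup>2) \<partial>gaussian)"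
    by (simp add: nn_integral_add nn_integral_cmult)
  also have "\<dots> \<le> ennreal (1 / 2) * ennreal B + ennreal (1 / 2) * ennreal (exp tilt)"
  proof (intro add_mono mult_left_mono inverse_second_moment_le)
    have "(\<Sum>\<sigma>\<in>S. \<Sum>\<tau>\<in>S. ?F \<sigma> \<tau> * exp (cov \<sigma> \<tau>)) / (real (card S))\<^sup>2 \<le> B"
      using exp_moment finite_S S_nonempty by (simp add: divide_le_eq card_gt_0_iff exp_add mult.commute)
    then show "(\<integral>\<^sup>+x. ennreal ((Z x / mean_Z)\<^sup>2 * pair_average ?F x) \<partial>gaussian) \<le> ennreal B"
      by (subst second_moment) (auto intro: ennreal_leI)
  qed auto
  also have "\<dots> = ennreal ((B + exp tilt) / 2)"
    using B_nonneg by (subst (1 2) ennreal_mult[symmetric], simp_all del: ennreal_half) (simp add: add_divide_distrib flip: ennreal_plus)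
  finally show ?thesis .
qed

end

section \<open>Exponential moments of block overlaps of random signs\<close>

text \<open>
The fair sign is subgaussian: the auxiliary inequality behind Hoeffding's lemma with \<open>p = 1 / 2\<close>.
\<close>
lemma exp_add_exp_minus_le: "exp x + exp (-x) \<le> 2 * exp (x\<^sup>2 / 2)" for x :: real
proof -
  have pos: "exp x + exp (-x) \<le> 2 * exp (x\<^sup>2 / 2)" if "0 \<le> x" for x :: real
  proof -
    have "ln (1 + (1 / 2) * (exp (2 * x) - 1)) \<le> x + x\<^sup>2 / 2"
      using Hoeffdings_lemma_aux[of "2 * x" "1 / 2"] that by (simp add: power_mult_distrib)
    moreover have half: "1 + (1 / 2) * (exp (2 * x) - 1) = (1 + exp (2 * x)) / 2" by (simp add: field_simps)
    ultimately have "exp (ln ((1 + exp (2 * x)) / 2)) \<le> exp (x + x\<^sup>2 / 2)" by (simp only: exp_le_cancel_iff)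
    moreover have "exp (ln ((1 + exp (2 * x)) / 2)) = (1 + exp (2 * x)) / 2" by (rule exp_ln) (simp add: add_pos_pos)
    ultimately have "(1 + exp (2 * x)) / 2 \<le> exp (x + x\<^sup>2 / 2)" by (simp only:)
    hence "1 + exp (2 * x) \<le> 2 * exp (x + x\<^sup>2 / 2)" by (simp add: divide_le_eq mult.commute)
    hence "exp (-x) * (1 + exp (2 * x)) \<le> exp (-x) * (2 * exp (x + x\<^sup>2 / 2))" by (intro mult_left_mono) auto
    then show ?thesis by (simp add: distrib_left mult_exp_exp mult.left_commute)
  qed
  from pos[of x] pos[of "-x"] show ?thesis by (cases "0 \<le> x") (auto simp: add.commute)
qed

lemma sum_exp_linear_cube_le:
  fixes \<theta> :: "'i \<Rightarrow> real"
  assumes "finite J"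
  shows "(\<Sum>\<sigma>\<in>PiE J (\<lambda>_. {-1, 1}). exp (\<Sum>i\<in>J. \<theta> i * \<sigma> i)) \<le> 2 ^ card J * exp (\<Sum>i\<in>J. (\<theta> i)\<^sup>2 / 2)"
proof -
  have "(\<Sum>\<sigma>\<in>PiE J (\<lambda>_. {-1, 1}). exp (\<Sum>i\<in>J. \<theta> i * \<sigma> i)) = (\<Prod>i\<in>J. \<Sum>v\<in>{-1, 1}. exp (\<theta> i * v))"
    by (subst prod_sum_PiE) (use assms in \<open>auto simp: exp_sum\<close>)
  also have "\<dots> \<le> (\<Prod>i\<in>J. 2 * exp ((\<theta> i)\<^sup>2 / 2))"
    using exp_add_exp_minus_le by (intro prod_mono) (auto simp: add.commute intro: add_nonneg_nonneg)
  also have "\<dots> = 2 ^ card J * exp (\<Sum>i\<in>J. (\<theta> i)\<^sup>2 / 2)"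
    using assms by (simp add: prod.distrib exp_sum)
  finally show ?thesis .
qed

text \<open>
Linearize each square by an independent Gaussian \<open>z s\<close>; conditionally on \<open>z\<close> the signs are independent
and subgaussian, and what remains is the product of \<open>m\<close> integrals of \<open>exp (c * z\<^sup>2)\<close>, finite
exactly for \<open>c < 1 / 2\<close>. The block sizes cancel, so the bound depends only on the number of blocks.
\<close>
lemma sum_exp_block_squares_cube_le:
  fixes I :: "nat \<Rightarrow> 'i set" and \<tau> :: "'i \<Rightarrow> real"
  assumes J: "finite J" "(\<Union>s<m. I s) = J" and disj: "disjoint_family_on I {..<m}"
    and ne: "\<And>s. s < m \<Longrightarrow> I s \<noteq> {}"
    and \<tau>: "\<And>i. i \<in> J \<Longrightarrow> (\<tau> i)\<^sup>2 = 1"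
    and c: "0 \<le> c" "c < 1 / 2"
  shows "(\<Sum>\<sigma>\<in>PiE J (\<lambda>_. {-1, 1}). exp (c * (\<Sum>s<m. (\<Sum>i\<in>I s. \<sigma> i * \<tau> i)\<^sup>2 / real (card (I s)))))
    \<le> 2 ^ card J * (1 / sqrt (1 - 2 * c)) ^ m"
proof -
  let ?C = "PiE J (\<lambda>_. {-1, 1 :: real})" and ?G = "\<Pi>\<^sub>M s\<in>{..<m}. std_gaussian"
  have fin: "finite (I s)" if "s < m" for s using J that by (auto intro: finite_subset)
  have "\<forall>i\<in>J. \<exists>s. s < m \<and> i \<in> I s" using J by auto
  then obtain sp where sp: "\<And>i. i \<in> J \<Longrightarrow> sp i < m \<and> i \<in> I (sp i)" by (auto simp: bchoice_iff)
  have sp_eq: "sp i = s" if "s < m" "i \<in> I s" for i s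
  proof -
    have "i \<in> J" using that J by auto
    then show ?thesis using sp[of i] that disj unfolding disjoint_family_on_def by blast
  qed
  have sum_J: "(\<Sum>i\<in>J. f i) = (\<Sum>s<m. \<Sum>i\<in>I s. f i)" for f :: "'i \<Rightarrow> real"
    unfolding J(2)[symmetric] using disj fin
    by (intro sum.UNION_disjoint) (auto simp: disjoint_family_on_def)
  define k where "k s = sqrt (2 * c / real (card (I s)))" for s
  have k: "(k s)\<^sup>2 = 2 * c / real (card (I s))" for s using c by (simp add: k_def)
  define \<theta> where "\<theta> z i = z (sp i) * k (sp i) * \<tau> i" for z :: "nat \<Rightarrow> real" and i
  have linear: "(\<Sum>s<m. (k s * (\<Sum>i\<in>I s. \<sigma> i * \<tau> i)) * z s) = (\<Sum>i\<in>J. \<theta> z i * \<sigma> i)" for \<sigma> :: "'i \<Rightarrow> real" and z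
    unfolding sum_J by (auto intro!: sum.cong simp: \<theta>_def sp_eq sum_distrib_left sum_distrib_right mult_ac)
  have square: "(\<Sum>i\<in>J. (\<theta> z i)\<^sup>2 / 2) = (\<Sum>s<m. c * (z s)\<^sup>2)" for z
  proof -
    have "(\<Sum>i\<in>I s. (\<theta> z i)\<^sup>2 / 2) = c * (z s)\<^sup>2" if s: "s < m" for s
    proof -
      have "(\<Sum>i\<in>I s. (\<theta> z i)\<^sup>2 / 2) = (\<Sum>i\<in>I s. (z s)\<^sup>2 * (2 * c / real (card (I s))) / 2)"
        using s \<tau> J by (intro sum.cong) (auto simp: \<theta>_def sp_eq power_mult_distrib k)
      also have "\<dots> = c * (z s)\<^sup>2" using fin[OF s] ne[OF s] by simp
      finally show ?thesis .
    qed
    then show ?thesis by (simp add: sum_J)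
  qed
  have "ennreal (\<Sum>\<sigma>\<in>?C. exp (c * (\<Sum>s<m. (\<Sum>i\<in>I s. \<sigma> i * \<tau> i)\<^sup>2 / real (card (I s)))))
    = (\<Sum>\<sigma>\<in>?C. ennreal (exp (\<Sum>s<m. (k s * (\<Sum>i\<in>I s. \<sigma> i * \<tau> i))\<^sup>2 / 2)))"
  proof -
    have "c * (\<Sum>s<m. (\<Sum>i\<in>I s. \<sigma> i * \<tau> i)\<^sup>2 / real (card (I s))) = (\<Sum>s<m. (k s * (\<Sum>i\<in>I s. \<sigma> i * \<tau> i))\<^sup>2 / 2)" for \<sigma>
      by (subst sum_distrib_left, intro sum.cong) (auto simp: power_mult_distrib k)
    then show ?thesis by simp
  qed
  also have "\<dots> = (\<Sum>\<sigma>\<in>?C. \<integral>\<^sup>+z. ennreal (exp (\<Sum>i\<in>J. \<theta> z i * \<sigma> i)) \<partial>?G)"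
    by (subst nn_integral_exp_linear_gaussian[symmetric]) (auto simp: linear)
  also have "\<dots> = (\<integral>\<^sup>+z. ennreal (\<Sum>\<sigma>\<in>?C. exp (\<Sum>i\<in>J. \<theta> z i * \<sigma> i)) \<partial>?G)"
  proof (subst nn_integral_sum[symmetric])
    fix \<sigma>
    show "(\<lambda>z. ennreal (exp (\<Sum>i\<in>J. \<theta> z i * \<sigma> i))) \<in> borel_measurable ?G"
      unfolding linear[symmetric] by measurable
  qed (simp add: sum_nonneg)
  also have "\<dots> \<le> (\<integral>\<^sup>+z. ennreal (2 ^ card J) * (\<Prod>s<m. ennreal (exp (c * (z s)\<^sup>2))) \<partial>?G)"
  proof (rule nn_integral_mono)
    fix z
    have "(\<Sum>\<sigma>\<in>?C. exp (\<Sum>i\<in>J. \<theta> z i * \<sigma> i)) \<le> 2 ^ card J * (\<Prod>s<m. exp (c * (z s)\<^sup>2))"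
      using sum_exp_linear_cube_le[OF J(1), of "\<theta> z"] by (simp add: square exp_sum)
    from ennreal_leI[OF this] show "ennreal (\<Sum>\<sigma>\<in>?C. exp (\<Sum>i\<in>J. \<theta> z i * \<sigma> i))
       \<le> ennreal (2 ^ card J) * (\<Prod>s<m. ennreal (exp (c * (z s)\<^sup>2)))"
      by (simp add: ennreal_mult prod_nonneg prod_ennreal)
  qed
  also have "\<dots> = ennreal (2 ^ card J) * (\<Prod>s<m. \<integral>\<^sup>+z. ennreal (exp (c * z\<^sup>2)) \<partial>std_gaussian)"
    by (subst nn_integral_cmult, simp, subst std_gaussian_product.product_nn_integral_prod) auto
  also have "\<dots> = ennreal (2 ^ card J * (1 / sqrt (1 - 2 * c)) ^ m)"
    using c by (simp add: nn_integral_exp_square_std_gaussian ennreal_mult ennreal_power)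
  finally show ?thesis using c by (subst (asm) ennreal_le_iff) auto
qed

section \<open>Orthogonal diagonalization of real symmetric matrices\<close>

unbundle no inner_syntax and no vec_syntax

lemma real_scalar_prod_self:
  fixes w :: "real Matrix.vec"
  assumes "w \<in> carrier_vec n"
  shows "scalar_prod w w = (\<Sum>i<n. (w $ i)\<^sup>2)"
  using assms by (simp add: scalar_prod_def power2_eq_square lessThan_atLeast0)

lemma real_scalar_prod_self_eq_0_iff:
  fixes w :: "real Matrix.vec"
  assumes "w \<in> carrier_vec n"
  shows "scalar_prod w w = 0 \<longleftrightarrow> w = 0\<^sub>v n"
  using assms by (auto simp: real_scalar_prod_self[OF assms] sum_nonneg_eq_0_iff)

text \<open>
A complex eigenvector exists by the fundamental theorem of algebra. Symmetry forces its eigenvalue to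
be real, so its real and imaginary parts satisfy the eigenvalue equation, and one of them is nonzero.
\<close>
lemma real_symmetric_has_eigenvector:
  fixes A :: "real Matrix.mat"
  assumes A: "A \<in> carrier_mat n n" and sym: "transpose_mat A = A" and n: "0 < n"
  obtains e v where "v \<in> carrier_vec n" "v \<noteq> 0\<^sub>v n" "A *\<^sub>v v = e \<cdot>\<^sub>v v"
proof -
  define C where "C = map_mat complex_of_real A"
  have C: "C \<in> carrier_mat n n" using A by (simp add: C_def)
  obtain z where "z \<in> spectrum C" using spectrum_non_empty[OF C n] by auto
  then obtain u where u: "u \<in> carrier_vec n" "u \<noteq> 0\<^sub>v n" "C *\<^sub>v u = z \<cdot>\<^sub>v u"
    using C unfolding spectrum_def eigenvalue_def eigenvector_def by auto
  define x y where "x = map_vec Re u" and "y = map_vec Im u"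
  have xy: "x \<in> carrier_vec n" "y \<in> carrier_vec n" using u(1) by (auto simp: x_def y_def)
  have Cu: "(\<Sum>j<n. complex_of_real (A $$ (i, j)) * u $ j) = z * u $ i" if "i < n" for i
  proof -
    have "(C *\<^sub>v u) $ i = (\<Sum>j<n. complex_of_real (A $$ (i, j)) * u $ j)"
      using A C u(1) that by (simp add: C_def scalar_prod_def lessThan_atLeast0)
    then show ?thesis using u that by simp
  qed
  have Ax: "A *\<^sub>v x = Re z \<cdot>\<^sub>v x - Im z \<cdot>\<^sub>v y"
  proof (rule eq_vecI)
    fix i assume "i < dim_vec (Re z \<cdot>\<^sub>v x - Im z \<cdot>\<^sub>v y)"
    hence i: "i < n" using xy by simp
    have "(A *\<^sub>v x) $ i = (\<Sum>j<n. A $$ (i, j) * Re (u $ j))"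
      using A u(1) i by (simp add: x_def scalar_prod_def lessThan_atLeast0)
    also have "\<dots> = Re (\<Sum>j<n. complex_of_real (A $$ (i, j)) * u $ j)" by simp
    finally show "(A *\<^sub>v x) $ i = (Re z \<cdot>\<^sub>v x - Im z \<cdot>\<^sub>v y) $ i"
      using u(1) i by (simp add: Cu x_def y_def)
  qed (use A xy in auto)
  have Ay: "A *\<^sub>v y = Im z \<cdot>\<^sub>v x + Re z \<cdot>\<^sub>v y"
  proof (rule eq_vecI)
    fix i assume "i < dim_vec (Im z \<cdot>\<^sub>v x + Re z \<cdot>\<^sub>v y)"
    hence i: "i < n" using xy by simp
    have "(A *\<^sub>v y) $ i = (\<Sum>j<n. A $$ (i, j) * Im (u $ j))"
      using A u(1) i by (simp add: y_def scalar_prod_def lessThan_atLeast0)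
    also have "\<dots> = Im (\<Sum>j<n. complex_of_real (A $$ (i, j)) * u $ j)" by simp
    finally show "(A *\<^sub>v y) $ i = (Im z \<cdot>\<^sub>v x + Re z \<cdot>\<^sub>v y) $ i"
      using u(1) i by (simp add: Cu x_def y_def)
  qed (use A xy in auto)
  have nz: "x \<noteq> 0\<^sub>v n \<or> y \<noteq> 0\<^sub>v n"
  proof (rule ccontr)
    assume "\<not> ?thesis"
    hence "x $ i = 0" "y $ i = 0" if "i < n" for i using that by auto
    hence "u $ i = 0" if "i < n" for i using that u(1) by (auto simp: x_def y_def complex_eq_iff)
    hence "u = 0\<^sub>v n" using u(1) by auto
    with u(2) show False by simp
  qed
  have sq: "0 \<le> scalar_prod w w" "scalar_prod w w = 0 \<longleftrightarrow> w = 0\<^sub>v n" if "w \<in> carrier_vec n" for w :: "real Matrix.vec"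
    using real_scalar_prod_self_eq_0_iff[OF that] by (auto simp: real_scalar_prod_self[OF that] sum_nonneg)
  have "scalar_prod (A *\<^sub>v y) x = scalar_prod y (A *\<^sub>v x)"
    using transpose_vec_mult_scalar[OF A xy] sym by simp
  hence "Im z * (scalar_prod x x + scalar_prod y y) = 0"
    using xy comm_scalar_prod[OF xy] unfolding Ax Ay
    by (simp add: add_scalar_prod_distrib[of _ n] scalar_prod_minus_distrib[of _ n] algebra_simps)
  moreover have "scalar_prod x x + scalar_prod y y \<noteq> 0"
    using sq[OF xy(1)] sq[OF xy(2)] nz by (smt (verit))
  ultimately have "Im z = 0" by simp
  hence "A *\<^sub>v x = Re z \<cdot>\<^sub>v x" "A *\<^sub>v y = Re z \<cdot>\<^sub>v y" using Ax Ay xy by auto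
  with nz xy that show thesis by blast
qed

text \<open>
Complete \<open>v\<close> to a basis, orthogonalize by Gram-Schmidt, which keeps the first vector, and normalize.
\<close>
lemma orthogonal_matrix_with_first_column:
  fixes v :: "real Matrix.vec"
  assumes v: "v \<in> carrier_vec n" and v0: "v \<noteq> 0\<^sub>v n"
  obtains U c where "U \<in> carrier_mat n n" "transpose_mat U * U = 1\<^sub>m n" "col U 0 = c \<cdot>\<^sub>v v"
proof -
  have n: "0 < n" using v v0 by (cases n) auto
  interpret cof_vec_space n "TYPE(real)" .
  note b = basis_completion[OF v v0]
  define ws where "ws = gram_schmidt n (basis_completion v)"
  note gs = gram_schmidt_result[OF b(2,4,5) ws_def]
  have len: "length ws = n" using gs(4) b(6) by simp
  obtain vs where vs: "basis_completion v = v # vs" using b(6,7) n by (cases "basis_completion v") auto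
  have hd: "ws ! 0 = v" 
  proof -
    have "ws \<noteq> []" using len n by auto
    then show ?thesis using gram_schmidt_hd[OF v, of vs] by (simp add: hd_conv_nth ws_def vs)
  qed
  have wsc: "ws ! i \<in> carrier_vec n" if "i < n" for i using gs(3) len that by (auto simp: subset_iff)
  have orth: "scalar_prod (ws ! i) (ws ! j) = 0 \<longleftrightarrow> i \<noteq> j" if "i < n" "j < n" for i j
    using corthogonalD[OF gs(2), of i j] that len by simp
  have pos: "0 < scalar_prod (ws ! i) (ws ! i)" if "i < n" for i
  proof -
    have "0 \<le> scalar_prod (ws ! i) (ws ! i)" by (simp add: real_scalar_prod_self[OF wsc[OF that]] sum_nonneg)
    with orth[OF that that] show ?thesis by simp
  qed
  define k where "k i = 1 / sqrt (scalar_prod (ws ! i) (ws ! i))" for i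
  define U where "U = mat_of_cols n (map (\<lambda>i. k i \<cdot>\<^sub>v (ws ! i)) [0..<n])"
  have U: "U \<in> carrier_mat n n" by (simp add: U_def mat_of_cols_def)
  have col: "col U i = k i \<cdot>\<^sub>v (ws ! i)" if "i < n" for i
    using that wsc[OF that] unfolding U_def by (subst col_mat_of_cols) auto
  have "transpose_mat U * U = 1\<^sub>m n"
  proof (rule eq_matI)
    fix i j assume "i < dim_row (1\<^sub>m n :: real Matrix.mat)" "j < dim_col (1\<^sub>m n :: real Matrix.mat)"
    hence ij: "i < n" "j < n" by auto
    have "(transpose_mat U * U) $$ (i, j) = k i * (k j * scalar_prod (ws ! i) (ws ! j))"
      using U ij wsc[OF ij(1), THEN carrier_vecD] wsc[OF ij(2), THEN carrier_vecD] by (simp add: col scalar_prod_smult_left scalar_prod_smult_right)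
    also have "\<dots> = 1\<^sub>m n $$ (i, j)"
    proof (cases "i = j")
      case True
      then show ?thesis using pos[OF ij(1)] ij by (simp add: k_def)
    qed (use orth[OF ij] ij in simp)
    finally show "(transpose_mat U * U) $$ (i, j) = 1\<^sub>m n $$ (i, j)" .
  qed (use U in auto)
  with that[OF U _ ] col[OF n] hd show thesis by simp
qed

text \<open>
Induction on the dimension: in an orthonormal basis starting with an eigenvector the matrix is block
diagonal, with a \<open>1 \<times> 1\<close> block and a symmetric block of smaller size.
\<close>
theorem real_symmetric_orthogonal_diagonalization:
  fixes A :: "real Matrix.mat"
  assumes "A \<in> carrier_mat n n" and "transpose_mat A = A"
  shows "\<exists>U d. U \<in> carrier_mat n n \<and> transpose_mat U * U = 1\<^sub>m n \<and> A = U * mat_diag n d * transpose_mat U"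
  using assms
proof (induction n arbitrary: A)
  case 0
  then show ?case by (intro exI[of _ "1\<^sub>m 0"]) (auto intro!: eq_matI)
next
  case (Suc n)
  let ?N = "Suc n"
  note A = Suc.prems(1) and sym = Suc.prems(2)
  obtain e v where v: "v \<in> carrier_vec ?N" "v \<noteq> 0\<^sub>v ?N" "A *\<^sub>v v = e \<cdot>\<^sub>v v"
    using real_symmetric_has_eigenvector[OF A sym zero_less_Suc] by blast
  obtain U c where U: "U \<in> carrier_mat ?N ?N" "transpose_mat U * U = 1\<^sub>m ?N" "col U 0 = c \<cdot>\<^sub>v v"
    using orthogonal_matrix_with_first_column[OF v(1,2)] by auto
  note UT = transpose_carrier_mat[THEN iffD2, OF U(1)]
  have UUT: "U * transpose_mat U = 1\<^sub>m ?N" by (rule mat_mult_left_right_inverse[OF UT U(1,2)])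
  define A' where "A' = transpose_mat U * (A * U)"
  have AU: "A * U \<in> carrier_mat ?N ?N" using A U by simp
  have A': "A' \<in> carrier_mat ?N ?N" using UT AU by (simp add: A'_def)
  have A'sym: "transpose_mat A' = A'"
    unfolding A'_def using A U(1) UT by (simp add: transpose_mult[OF UT AU] transpose_mult[OF A U(1)] sym assoc_mult_mat[of _ ?N ?N _ ?N _ ?N])
  have AA': "A = U * A' * transpose_mat U"
  proof -
    have "U * A' * transpose_mat U = (U * transpose_mat U) * A * (U * transpose_mat U)"
      unfolding A'_def using A U(1) UT AU by (simp add: assoc_mult_mat[of _ ?N ?N _ ?N _ ?N])
    then show ?thesis using A by (simp add: UUT)
  qed
  have col0: "A' $$ (i, 0) = (if i = 0 then e else 0)" if "i < ?N" for i
  proof -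
    have "col (A * U) 0 = e \<cdot>\<^sub>v col U 0"
    proof -
      have "col (A * U) 0 = A *\<^sub>v (c \<cdot>\<^sub>v v)" using col_mult2[OF A U(1), of 0] by (simp add: U(3))
      then show ?thesis by (simp add: mult_mat_vec[OF A v(1)] v(3) U(3) smult_smult_assoc mult.commute)
    qed
    hence "A' $$ (i, 0) = e * scalar_prod (col U i) (col U 0)"
      using A U(1) UT AU that by (simp add: A'_def scalar_prod_smult_right)
    also have "scalar_prod (col U i) (col U 0) = (transpose_mat U * U) $$ (i, 0)"
      using U(1) that by simp
    finally show ?thesis using that by (simp add: U(2))
  qed
  have row0: "A' $$ (0, i) = (if i = 0 then e else 0)" if "i < ?N" for i
    using col0[OF that] A' that A'sym index_transpose_mat(1)[of i A' 0] by auto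
  define A3 where "A3 = Matrix.mat n n (\<lambda>(i, j). A' $$ (Suc i, Suc j))"
  let ?e = "Matrix.mat 1 1 (\<lambda>_. e)"
  have A3: "A3 \<in> carrier_mat n n" by (simp add: A3_def)
  have block: "A' = four_block_mat ?e (0\<^sub>m 1 n) (0\<^sub>m n 1) A3"
    using A' col0 row0 by (intro eq_matI) (auto simp: A3_def)
  have "transpose_mat A3 = A3"
  proof (rule eq_matI)
    fix i j assume "i < dim_row A3" "j < dim_col A3"
    then show "transpose_mat A3 $$ (i, j) = A3 $$ (i, j)"
      using A' arg_cong[OF A'sym, of "\<lambda>M. M $$ (Suc i, Suc j)"] by (simp add: A3_def)
  qed (use A3 in auto)
  from Suc.IH[OF A3 this] obtain P d where P: "P \<in> carrier_mat n n" "transpose_mat P * P = 1\<^sub>m n"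
    and A3P: "A3 = P * mat_diag n d * transpose_mat P" by auto
  define Q where "Q = four_block_mat (1\<^sub>m 1) (0\<^sub>m 1 n) (0\<^sub>m n 1) P"
  define d' where "d' = case_nat e d"
  have Q: "Q \<in> carrier_mat ?N ?N" using four_block_carrier_mat[OF one_carrier_mat[of 1] P(1)] by (simp add: Q_def)
  have QT: "transpose_mat Q = four_block_mat (1\<^sub>m 1) (0\<^sub>m 1 n) (0\<^sub>m n 1) (transpose_mat P)"
    unfolding Q_def using P by (subst transpose_four_block_mat) auto
  have QTc: "transpose_mat Q \<in> carrier_mat ?N ?N" using Q by simp
  have QQ: "transpose_mat Q * Q = 1\<^sub>m ?N"
    unfolding QT unfolding Q_def using P by (subst mult_four_block_mat[of _ 1 1 _ n _ n _ _ 1 _ n]) (auto intro!: eq_matI)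
  have D: "mat_diag ?N d' = four_block_mat ?e (0\<^sub>m 1 n) (0\<^sub>m n 1) (mat_diag n d)"
    by (intro eq_matI) (auto simp: mat_diag_def d'_def split: nat.splits)
  have QD: "Q * mat_diag ?N d' * transpose_mat Q = A'"
  proof -
    let ?X = "P * mat_diag n d"
    have X: "?X \<in> carrier_mat n n" "?X * transpose_mat P \<in> carrier_mat n n" using P(1) by auto
    have 1: "Q * mat_diag ?N d' = four_block_mat ?e (0\<^sub>m 1 n) (0\<^sub>m n 1) (P * mat_diag n d)"
      unfolding D Q_def using P X
      by (subst mult_four_block_mat[of _ 1 1 _ n _ n _ _ 1 _ n]) (auto simp: left_mult_zero_mat[OF mat_diag_dim])
    show ?thesis unfolding 1 QT block A3P using P X
      by (subst mult_four_block_mat[of _ 1 1 _ n _ n _ _ 1 _ n])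
        (auto simp: right_mult_zero_mat[OF X(1)] left_add_zero_mat[OF X(2)])
  qed
  have UQ: "U * Q \<in> carrier_mat ?N ?N" using U Q by simp
  have T: "transpose_mat (U * Q) = transpose_mat Q * transpose_mat U" by (rule transpose_mult[OF U(1) Q])
  have Dc: "mat_diag ?N d' \<in> carrier_mat ?N ?N" by (rule mat_diag_dim)
  have "transpose_mat (U * Q) * (U * Q) = transpose_mat Q * (transpose_mat U * U) * Q"
    unfolding T using U(1) Q UT QTc by (simp add: assoc_mult_mat[of _ ?N ?N _ ?N _ ?N])
  also have "\<dots> = 1\<^sub>m ?N" using QTc Q by (simp add: U(2) QQ)
  finally have 1: "transpose_mat (U * Q) * (U * Q) = 1\<^sub>m ?N" .
  have "(U * Q) * D * transpose_mat (U * Q) = U * (Q * D * transpose_mat Q) * transpose_mat U"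
    if "D \<in> carrier_mat ?N ?N" for D
    unfolding T using U(1) Q UT QTc that by (simp add: assoc_mult_mat[of _ ?N ?N _ ?N _ ?N])
  from this[OF Dc]
  have "A = (U * Q) * mat_diag ?N d' * transpose_mat (U * Q)" by (simp add: QD AA')
  with 1 UQ show ?case by blast
qed

lemma mat_diag_mult_vec_index:
  fixes v :: "real Matrix.vec"
  assumes "v \<in> carrier_vec n" "i < n"
  shows "(mat_diag n d *\<^sub>v v) $ i = d i * v $ i"
proof -
  have "(mat_diag n d *\<^sub>v v) $ i = (\<Sum>j<n. (if i = j then d j else 0) * v $ j)"
    using assms by (simp add: mat_diag_def scalar_prod_def lessThan_atLeast0)
  also have "\<dots> = (\<Sum>j<n. if j = i then d j * v $ j else 0)" by (intro sum.cong) auto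
  finally show ?thesis using assms(2) by (simp add: sum.delta)
qed

lemma quadratic_form_of_diagonalization:
  fixes U :: "real Matrix.mat" and y :: "real Matrix.vec"
  assumes U: "U \<in> carrier_mat n n" and y: "y \<in> carrier_vec n"
  shows "scalar_prod y ((U * mat_diag n d * transpose_mat U) *\<^sub>v y) = (\<Sum>i<n. d i * ((transpose_mat U *\<^sub>v y) $ i)\<^sup>2)"
proof -
  define z where "z = transpose_mat U *\<^sub>v y"
  have UT: "transpose_mat U \<in> carrier_mat n n" using U by simp
  have z: "z \<in> carrier_vec n" unfolding z_def using UT y by simp
  have D: "mat_diag n d \<in> carrier_mat n n" by (rule mat_diag_dim)
  have Dz: "mat_diag n d *\<^sub>v z \<in> carrier_vec n" by (rule mult_mat_vec_carrier[OF D z])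
  have "(U * mat_diag n d * transpose_mat U) *\<^sub>v y = (U * mat_diag n d) *\<^sub>v z"
    unfolding z_def by (rule assoc_mult_mat_vec[OF mult_carrier_mat[OF U D] UT y])
  also have "\<dots> = U *\<^sub>v (mat_diag n d *\<^sub>v z)" by (rule assoc_mult_mat_vec[OF U D z])
  finally have "scalar_prod y ((U * mat_diag n d * transpose_mat U) *\<^sub>v y) = scalar_prod z (mat_diag n d *\<^sub>v z)"
    using transpose_vec_mult_scalar[OF U Dz y] by (simp add: z_def)
  also have "\<dots> = (\<Sum>i<n. d i * (z $ i)\<^sup>2)"
    using z mat_diag_mult_vec_index[OF z, of _ d] unfolding scalar_prod_def carrier_vecD[OF Dz]
    by (simp add: lessThan_atLeast0 power2_eq_square mult_ac)
  finally show ?thesis by (simp add: z_def)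
qed

lemma orthogonal_mat_preserves_norm:
  fixes U :: "real Matrix.mat" and y :: "real Matrix.vec"
  assumes U: "U \<in> carrier_mat n n" "transpose_mat U * U = 1\<^sub>m n" and y: "y \<in> carrier_vec n"
  shows "(\<Sum>i<n. ((transpose_mat U *\<^sub>v y) $ i)\<^sup>2) = (\<Sum>i<n. (y $ i)\<^sup>2)"
proof -
  have UT: "transpose_mat U \<in> carrier_mat n n" using U by simp
  have UUT: "U * transpose_mat U = 1\<^sub>m n" by (rule mat_mult_left_right_inverse[OF UT U])
  have "(\<Sum>i<n. 1 * ((transpose_mat U *\<^sub>v y) $ i)\<^sup>2) = scalar_prod y ((U * mat_diag n (\<lambda>_. 1) * transpose_mat U) *\<^sub>v y)"
    by (rule quadratic_form_of_diagonalization[OF U(1) y, symmetric])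
  also have "\<dots> = scalar_prod y y" using U(1) y by (simp add: UUT)
  finally show ?thesis by (simp add: real_scalar_prod_self[OF y])
qed

text \<open>
The matrix \<open>W\<close> that changes one eigenbasis into the other has \<open>W $$ (i, j) \<noteq> 0\<close> only where the
eigenvalues \<open>d j\<close> and \<open>d' i\<close> agree; hence it also intertwines their absolute values.
\<close>
lemma is_spectral_abs_unique:
  assumes "is_spectral_abs n A V" and "is_spectral_abs n A V'"
  shows "V = V'"
proof -
  obtain U d where U: "U \<in> carrier_mat n n" "transpose_mat U * U = 1\<^sub>m n"
    and A: "A = U * mat_diag n d * transpose_mat U" and V: "V = U * mat_diag n (\<lambda>i. \<bar>d i\<bar>) * transpose_mat U"
    using assms(1) unfolding is_spectral_abs_def by auto
  obtain U' d' where U': "U' \<in> carrier_mat n n" "transpose_mat U' * U' = 1\<^sub>m n"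
    and A': "A = U' * mat_diag n d' * transpose_mat U'" and V': "V' = U' * mat_diag n (\<lambda>i. \<bar>d' i\<bar>) * transpose_mat U'"
    using assms(2) unfolding is_spectral_abs_def by auto
  have UT: "transpose_mat U \<in> carrier_mat n n" "transpose_mat U' \<in> carrier_mat n n" using U U' by auto
  have UUT: "U * transpose_mat U = 1\<^sub>m n" "U' * transpose_mat U' = 1\<^sub>m n"
    using mat_mult_left_right_inverse[OF UT(1) U] mat_mult_left_right_inverse[OF UT(2) U'] by auto
  define W where "W = transpose_mat U' * U"
  have W: "W \<in> carrier_mat n n" using UT U by (simp add: W_def)
  have conj: "transpose_mat U' * (U * D * transpose_mat U) * U = W * D" if D: "D \<in> carrier_mat n n" for D
  proof -
    have "transpose_mat U' * (U * D * transpose_mat U) * U = W * D * (transpose_mat U * U)"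
      unfolding W_def using U(1) UT D by (simp add: assoc_mult_mat[of _ n n _ n _ n])
    then show ?thesis using W D by (simp add: U(2) right_mult_one_mat[of _ n n])
  qed
  have conj': "transpose_mat U' * (U' * D * transpose_mat U') * U = D * W" if D: "D \<in> carrier_mat n n" for D
  proof -
    have "transpose_mat U' * (U' * D * transpose_mat U') * U = (transpose_mat U' * U') * (D * W)"
      unfolding W_def using U(1) U'(1) UT D by (simp add: assoc_mult_mat[of _ n n _ n _ n])
    then show ?thesis using W D by (simp add: U'(2) left_mult_one_mat[of _ n n])
  qed
  have unconj: "U' * (W * D) * transpose_mat U = U * D * transpose_mat U" if D: "D \<in> carrier_mat n n" for D
  proof -
    have "U' * (W * D) * transpose_mat U = (U' * transpose_mat U') * (U * D * transpose_mat U)"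
      unfolding W_def using U(1) U'(1) UT D by (simp add: assoc_mult_mat[of _ n n _ n _ n])
    then show ?thesis using U UT D by (simp add: UUT(2) left_mult_one_mat[of _ n n])
  qed
  have unconj': "U' * (D * W) * transpose_mat U = U' * D * transpose_mat U'" if D: "D \<in> carrier_mat n n" for D
  proof -
    have "U' * (D * W) * transpose_mat U = (U' * D * transpose_mat U') * (U * transpose_mat U)"
      unfolding W_def using U(1) U'(1) UT D by (simp add: assoc_mult_mat[of _ n n _ n _ n])
    then show ?thesis using U' UT D by (simp add: UUT(1) right_mult_one_mat[of _ n n])
  qed
  have comm: "W * mat_diag n d = mat_diag n d' * W"
  proof -
    have "W * mat_diag n d = transpose_mat U' * A * U" unfolding A by (rule conj[OF mat_diag_dim, symmetric])
    also have "\<dots> = mat_diag n d' * W" unfolding A' by (rule conj'[OF mat_diag_dim])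
    finally show ?thesis .
  qed
  have "W $$ (i, j) * \<bar>d j\<bar> = \<bar>d' i\<bar> * W $$ (i, j)" if "i < n" "j < n" for i j
  proof -
    have "W $$ (i, j) * d j = d' i * W $$ (i, j)"
      using arg_cong[OF comm, of "\<lambda>M. M $$ (i, j)"] that W
      by (simp add: mat_diag_mult_left[OF W] mat_diag_mult_right[OF W])
    then show ?thesis by (cases "W $$ (i, j) = 0") auto
  qed
  hence "W * mat_diag n (\<lambda>i. \<bar>d i\<bar>) = mat_diag n (\<lambda>i. \<bar>d' i\<bar>) * W"
    by (intro eq_matI) (auto simp: mat_diag_mult_left[OF W] mat_diag_mult_right[OF W])
  hence "U' * (W * mat_diag n (\<lambda>i. \<bar>d i\<bar>)) * transpose_mat U = U' * (mat_diag n (\<lambda>i. \<bar>d' i\<bar>) * W) * transpose_mat U"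
    by (rule arg_cong)
  then show ?thesis unfolding V V' unconj[OF mat_diag_dim] unconj'[OF mat_diag_dim] .
qed

lemma is_spectral_abs_spectral_abs:
  assumes "A \<in> carrier_mat n n" and "transpose_mat A = A"
  shows "is_spectral_abs n A (spectral_abs n A)"
proof -
  have "\<exists>V. is_spectral_abs n A V"
    using real_symmetric_orthogonal_diagonalization[OF assms] unfolding is_spectral_abs_def by blast
  hence "\<exists>!V. is_spectral_abs n A V" using is_spectral_abs_unique by blast
  then show ?thesis unfolding spectral_abs_def by (rule theI')
qed

lemma eigenvalue_le_spectral_radius:
  fixes B :: "real Matrix.mat"
  assumes B: "B \<in> carrier_mat n n" and v: "v \<in> carrier_vec n" "v \<noteq> 0\<^sub>v n" and ev: "B *\<^sub>v v = e \<cdot>\<^sub>v v"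
  shows "\<bar>e\<bar> \<le> spectral_radius (map_mat complex_of_real B)"
proof -
  have n: "0 < n" using v by (cases n) auto
  let ?C = "map_mat complex_of_real B" and ?u = "map_vec complex_of_real v"
  have C: "?C \<in> carrier_mat n n" using B by simp
  have ev': "?C *\<^sub>v ?u = complex_of_real e \<cdot>\<^sub>v ?u"
  proof (rule eq_vecI)
    fix i assume "i < dim_vec (complex_of_real e \<cdot>\<^sub>v ?u)"
    hence i: "i < n" using v by simp
    have "(?C *\<^sub>v ?u) $ i = complex_of_real ((B *\<^sub>v v) $ i)"
      using i B v by (simp add: scalar_prod_def)
    then show "(?C *\<^sub>v ?u) $ i = (complex_of_real e \<cdot>\<^sub>v ?u) $ i" using i v by (simp add: ev)
  qed (use B v in auto)
  have u: "?u \<in> carrier_vec n" "?u \<noteq> 0\<^sub>v n" using v by auto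
  have "complex_of_real e \<in> spectrum ?C"
    unfolding spectrum_def eigenvalue_def eigenvector_def
    using u ev' carrier_matD(1)[OF C] by (intro CollectI exI[of _ ?u]) (simp only: simp_thms)
  hence "norm (complex_of_real e) \<in> norm ` spectrum ?C" by blast
  from spectral_radius_mem_max(2)[OF C n this] show ?thesis by simp
qed

section \<open>Comparison of the quadratic form P with the covariance\<close>

text \<open>
Put \<open>y = \<Lambda>\<^sup>1\<^sup>/\<^sup>2 r\<close> and expand in an eigenbasis of \<open>A = \<Lambda>\<^sup>1\<^sup>/\<^sup>2 \<Delta>\<^sup>2 \<Lambda>\<^sup>1\<^sup>/\<^sup>2\<close>: the covariance form
has coefficients \<open>d i\<close> and \<open>P\<close> has coefficients \<open>\<bar>d i\<bar>\<close>. Each \<open>\<bar>d i\<bar>\<close> is at most \<open>\<rho>\<close> because \<open>\<Lambda>\<^sup>1\<^sup>/\<^sup>2\<close>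
intertwines \<open>\<Delta>\<^sup>2 \<Lambda>\<close> with \<open>A\<close>.
\<close>
lemma P_form_bounds:
  fixes m :: nat and Dsq :: "real Matrix.mat" and lam r :: "nat \<Rightarrow> real"
  defines "\<rho> \<equiv> spectral_radius (map_mat complex_of_real (Dsq * mat_diag m lam))"
  assumes Dsq: "Dsq \<in> carrier_mat m m" and sym: "transpose_mat Dsq = Dsq"
    and lam_pos: "\<And>s. s < m \<Longrightarrow> 0 < lam s"
  shows "(\<Sum>s<m. \<Sum>t<m. Dsq $$ (s, t) * (lam s * r s) * (lam t * r t)) \<le> P_form m Dsq lam (Matrix.vec m r)"
    and "0 \<le> P_form m Dsq lam (Matrix.vec m r)"
    and "P_form m Dsq lam (Matrix.vec m r) \<le> \<rho> * (\<Sum>s<m. lam s * (r s)\<^sup>2)"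
proof -
  let ?L = "sqrt_Lambda m lam" and ?x = "Matrix.vec m r"
  have L: "?L \<in> carrier_mat m m" unfolding sqrt_Lambda_def by (rule mat_diag_dim)
  have LT: "transpose_mat ?L = ?L" unfolding sqrt_Lambda_def mat_diag_def by (intro eq_matI) auto
  have x: "?x \<in> carrier_vec m" by simp
  define A where "A = ?L * Dsq * ?L"
  have A: "A \<in> carrier_mat m m" using L Dsq by (simp add: A_def)
  have LD: "?L * Dsq \<in> carrier_mat m m" using L Dsq by simp
  have Asym: "transpose_mat A = A"
    unfolding A_def
    unfolding transpose_mult[OF LD L] transpose_mult[OF L Dsq] LT sym
    by (rule assoc_mult_mat[OF L Dsq L, symmetric])
  obtain U d where U: "U \<in> carrier_mat m m" "transpose_mat U * U = 1\<^sub>m m"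
    and AU: "A = U * mat_diag m d * transpose_mat U"
    and VU: "spectral_abs m A = U * mat_diag m (\<lambda>i. \<bar>d i\<bar>) * transpose_mat U"
    using is_spectral_abs_spectral_abs[OF A Asym] unfolding is_spectral_abs_def by auto
  have UT: "transpose_mat U \<in> carrier_mat m m" using U by simp
  have V: "V_mat m Dsq lam \<in> carrier_mat m m"
    unfolding V_mat_def A_def[symmetric] VU
    by (rule mult_carrier_mat[OF mult_carrier_mat[OF U(1) mat_diag_dim] UT])
  define y where "y = ?L *\<^sub>v ?x"
  have y: "y \<in> carrier_vec m" unfolding y_def using L by simp
  have yi: "y $ i = sqrt (lam i) * r i" if "i < m" for i
    using that mat_diag_mult_vec_index[OF x that] by (simp add: y_def sqrt_Lambda_def)
  define z where "z = transpose_mat U *\<^sub>v y"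
  have sandwich: "scalar_prod ?x ((?L * M * ?L) *\<^sub>v ?x) = scalar_prod y (M *\<^sub>v y)" if M: "M \<in> carrier_mat m m" for M
  proof -
    have LM: "?L * M \<in> carrier_mat m m" using L M by simp
    have My: "M *\<^sub>v y \<in> carrier_vec m" using M y by simp
    have "(?L * M * ?L) *\<^sub>v ?x = ?L *\<^sub>v (M *\<^sub>v y)"
      using assoc_mult_mat_vec[OF LM L x] assoc_mult_mat_vec[OF L M y] by (simp add: y_def)
    then show ?thesis using transpose_vec_mult_scalar[OF L My x] by (simp add: LT y_def)
  qed
  have P: "P_form m Dsq lam ?x = (\<Sum>i<m. \<bar>d i\<bar> * (z $ i)\<^sup>2)"
    unfolding P_form_def sandwich[OF V] unfolding V_mat_def A_def[symmetric] VU z_def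
    by (rule quadratic_form_of_diagonalization[OF U(1) y])
  have Q: "(\<Sum>s<m. \<Sum>t<m. Dsq $$ (s, t) * (lam s * r s) * (lam t * r t)) = (\<Sum>i<m. d i * (z $ i)\<^sup>2)"
  proof -
    have "(\<Sum>i<m. d i * (z $ i)\<^sup>2) = scalar_prod y (A *\<^sub>v y)"
      unfolding AU z_def by (rule quadratic_form_of_diagonalization[OF U(1) y, symmetric])
    also have "\<dots> = (\<Sum>s<m. \<Sum>t<m. y $ s * (A $$ (s, t) * y $ t))"
      using A y by (simp add: scalar_prod_def lessThan_atLeast0 sum_distrib_left)
    also have "\<dots> = (\<Sum>s<m. \<Sum>t<m. Dsq $$ (s, t) * (lam s * r s) * (lam t * r t))"
    proof (intro sum.cong refl)
      fix s t assume st: "s \<in> {..<m}" "t \<in> {..<m}"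
      have "A $$ (s, t) = sqrt (lam s) * Dsq $$ (s, t) * sqrt (lam t)"
        using st Dsq unfolding A_def sqrt_Lambda_def
        by (subst mat_diag_mult_right[of _ m m]) (auto simp: mat_diag_mult_left[OF Dsq])
      hence "y $ s * (A $$ (s, t) * y $ t)
          = Dsq $$ (s, t) * ((sqrt (lam s) * sqrt (lam s)) * r s) * ((sqrt (lam t) * sqrt (lam t)) * r t)"
        using st by (simp only: yi lessThan_iff mult_ac)
      then show "y $ s * (A $$ (s, t) * y $ t) = Dsq $$ (s, t) * (lam s * r s) * (lam t * r t)"
        using st lam_pos by (simp add: less_imp_le)
    qed
    finally show ?thesis by simp
  qed
  show "(\<Sum>s<m. \<Sum>t<m. Dsq $$ (s, t) * (lam s * r s) * (lam t * r t)) \<le> P_form m Dsq lam ?x"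
    unfolding P Q by (intro sum_mono mult_right_mono) auto
  show "0 \<le> P_form m Dsq lam ?x" unfolding P by (intro sum_nonneg) auto
  have d: "\<bar>d i\<bar> \<le> \<rho>" if i: "i < m" for i
  proof -
    define u where "u = col U i"
    \<comment> \<open>\<open>w\<close> is the eigenvector of \<open>\<Delta>\<^sup>2 \<Lambda>\<close> that corresponds to the eigenvector \<open>u\<close> of \<open>A\<close>.\<close>
    define w where "w = Matrix.vec m (\<lambda>s. u $ s / sqrt (lam s))"
    have u: "u \<in> carrier_vec m" using U i by (simp add: u_def)
    have w: "w \<in> carrier_vec m" by (simp add: w_def)
    have Lw: "?L *\<^sub>v w = u"
    proof (rule eq_vecI)
      fix j assume "j < dim_vec u"
      hence j: "j < m" using u by simp
      show "(?L *\<^sub>v w) $ j = u $ j"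
        using j lam_pos[OF j] mat_diag_mult_vec_index[OF w j] by (simp add: w_def sqrt_Lambda_def)
    qed (use L u in auto)
    have Au: "A *\<^sub>v u = d i \<cdot>\<^sub>v u"
    proof -
      have UD: "U * mat_diag m d \<in> carrier_mat m m" using U mat_diag_dim[of m d] by simp
      have AUD: "A * U = U * mat_diag m d"
        unfolding AU using assoc_mult_mat[OF UD UT U(1)] by (simp only: U(2) right_mult_one_mat[OF UD])
      have "A *\<^sub>v u = col (A * U) i" unfolding u_def using col_mult2[OF A U(1) i] by simp
      also have "\<dots> = d i \<cdot>\<^sub>v u"
        unfolding AUD u_def using U i by (intro eq_vecI) (auto simp: mat_diag_mult_right[OF U(1)])
      finally show ?thesis .
    qed
    have inj: "v = v'" if "v \<in> carrier_vec m" "v' \<in> carrier_vec m" "?L *\<^sub>v v = ?L *\<^sub>v v'" for v v' :: "real Matrix.vec"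
    proof (rule eq_vecI)
      fix j assume "j < dim_vec v'"
      hence j: "j < m" using that by simp
      show "v $ j = v' $ j" 
        using mat_diag_mult_vec_index[OF that(1) j, of "\<lambda>s. sqrt (lam s)"]
          mat_diag_mult_vec_index[OF that(2) j, of "\<lambda>s. sqrt (lam s)"] that(3) lam_pos[OF j]
        by (simp add: sqrt_Lambda_def)
    qed (use that in auto)
    let ?B = "Dsq * mat_diag m lam"
    have B: "?B \<in> carrier_mat m m" using Dsq mat_diag_dim[of m lam] by simp
    have LL: "?L * ?L = mat_diag m lam"
      unfolding sqrt_Lambda_def mat_diag_diag using lam_pos by (intro eq_matI) (auto simp: mat_diag_def less_imp_le)
    have "?L *\<^sub>v (?B *\<^sub>v w) = A *\<^sub>v u"
    proof -
      have DL: "Dsq * ?L \<in> carrier_mat m m" using Dsq L by simp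
      have "?L *\<^sub>v (?B *\<^sub>v w) = ?L *\<^sub>v ((Dsq * ?L) *\<^sub>v (?L *\<^sub>v w))"
        unfolding LL[symmetric] assoc_mult_mat[OF Dsq L L, symmetric] by (simp add: assoc_mult_mat_vec[OF DL L w])
      also have "\<dots> = (?L * (Dsq * ?L)) *\<^sub>v u" unfolding Lw by (rule assoc_mult_mat_vec[OF L DL u, symmetric])
      finally show ?thesis by (simp add: A_def assoc_mult_mat[OF L Dsq L])
    qed
    also have "\<dots> = ?L *\<^sub>v (d i \<cdot>\<^sub>v w)" by (simp add: Au mult_mat_vec[OF L w] Lw)
    finally have Lev: "?L *\<^sub>v (?B *\<^sub>v w) = ?L *\<^sub>v (d i \<cdot>\<^sub>v w)" .
    have ev: "?B *\<^sub>v w = d i \<cdot>\<^sub>v w"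
      by (rule inj[OF mult_mat_vec_carrier[OF B w] _ Lev]) (use w in simp)
    have "scalar_prod u u = (transpose_mat U * U) $$ (i, i)" using U(1) i by (simp add: u_def)
    hence "scalar_prod u u = 1" using i by (simp add: U(2))
    hence "u \<noteq> 0\<^sub>v m" using real_scalar_prod_self_eq_0_iff[OF u] by auto
    hence "w \<noteq> 0\<^sub>v m" using Lw L by auto
    from eigenvalue_le_spectral_radius[OF B w this ev] show ?thesis by (simp add: \<rho>_def)
  qed
  have "P_form m Dsq lam ?x \<le> (\<Sum>i<m. \<rho> * (z $ i)\<^sup>2)"
    unfolding P using d by (intro sum_mono mult_right_mono) auto
  also have "\<dots> = \<rho> * (\<Sum>i<m. (y $ i)\<^sup>2)"
    using orthogonal_mat_preserves_norm[OF U y] by (simp add: z_def flip: sum_distrib_left)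
  also have "(\<Sum>i<m. (y $ i)\<^sup>2) = (\<Sum>s<m. lam s * (r s)\<^sup>2)"
    using lam_pos by (intro sum.cong) (auto simp: yi power_mult_distrib less_imp_le)
  finally show "P_form m Dsq lam ?x \<le> \<rho> * (\<Sum>s<m. lam s * (r s)\<^sup>2)" .
qed

section \<open>Representation of the disorder by standard Gaussians\<close>

lemma distr_std_gaussian_scale:
  assumes "0 \<le> v"
  shows "distr std_gaussian borel (\<lambda>x. sqrt v * x) = centered_gaussian v"
proof (cases "v = 0")
  case True
  have "distr std_gaussian borel (\<lambda>x. 0) = return borel (0::real)"
    by (intro measure_eqI) (auto simp: emeasure_distr std_gaussian.emeasure_space_1[simplified] split: split_indicator)
  then show ?thesis using True by (simp add: centered_gaussian_def)
next
  case False
  with assms have v: "0 < v" by simp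
  have "distributed std_gaussian lborel (\<lambda>x. x) std_normal_density"
    by (auto simp: distributed_def distr_id2)
  from std_gaussian.normal_density_affine[OF this, of "sqrt v" 0] v
  have "distributed std_gaussian lborel (\<lambda>x. sqrt v * x) (normal_density 0 (sqrt v))" by simp
  hence "distr std_gaussian lborel (\<lambda>x. sqrt v * x) = density lborel (normal_density 0 (sqrt v))"
    by (simp add: distributed_def)
  moreover have "distr std_gaussian lborel (\<lambda>x. sqrt v * x) = distr std_gaussian borel (\<lambda>x. sqrt v * x)"
    by (intro distr_cong) auto
  ultimately show ?thesis using False by (simp add: centered_gaussian_def)
qed

lemma distr_gaussian_product_scale:
  fixes v :: "'e \<Rightarrow> real"
  assumes E: "finite E" "E \<noteq> {}" and v: "\<And>e. e \<in> E \<Longrightarrow> 0 \<le> v e"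
  shows "distr (\<Pi>\<^sub>M e\<in>E. std_gaussian) (\<Pi>\<^sub>M e\<in>E. borel) (\<lambda>x. \<lambda>e\<in>E. sqrt (v e) * x e) = (\<Pi>\<^sub>M e\<in>E. centered_gaussian (v e))"
proof -
  let ?P = "\<Pi>\<^sub>M e\<in>E. std_gaussian"
  have P: "prob_space ?P" by (rule prob_space_PiM) (rule std_gaussian.prob_space_axioms)
  have comp: "distr ?P std_gaussian (\<lambda>x. x e) = std_gaussian" if "e \<in> E" for e
    using that by (intro distr_PiM_component) (auto simp: std_gaussian.prob_space_axioms)
  have "distr ?P ?P (\<lambda>x. \<lambda>e\<in>E. x e) = distr ?P ?P (\<lambda>x. x)"
    by (intro distr_cong) (auto simp: space_PiM PiE_def extensional_restrict)
  also have "\<dots> = (\<Pi>\<^sub>M e\<in>E. distr ?P std_gaussian (\<lambda>x. x e))"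
    by (simp add: distr_id2 comp cong: PiM_cong)
  finally have "prob_space.indep_vars ?P (\<lambda>_. std_gaussian) (\<lambda>e x. x e) E"
    by (subst prob_space.indep_vars_iff_distr_eq_PiM'[OF P E(2)]) auto
  hence "prob_space.indep_vars ?P (\<lambda>_. borel) (\<lambda>e x. sqrt (v e) * x e) E"
    by (rule prob_space.indep_vars_compose2[OF P]) auto
  hence "distr ?P (\<Pi>\<^sub>M e\<in>E. borel) (\<lambda>x. \<lambda>e\<in>E. sqrt (v e) * x e) = (\<Pi>\<^sub>M e\<in>E. distr ?P borel (\<lambda>x. sqrt (v e) * x e))"
    by (subst (asm) prob_space.indep_vars_iff_distr_eq_PiM'[OF P E(2)]) auto
  also have "\<dots> = (\<Pi>\<^sub>M e\<in>E. centered_gaussian (v e))"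
  proof (intro PiM_cong refl)
    fix e assume e: "e \<in> E"
    have "distr ?P borel (\<lambda>x. sqrt (v e) * x e) = distr (distr ?P std_gaussian (\<lambda>x. x e)) borel (\<lambda>x. sqrt (v e) * x)"
      using e by (subst distr_distr) (auto simp: comp_def)
    then show "distr ?P borel (\<lambda>x. sqrt (v e) * x e) = centered_gaussian (v e)"
      using e by (simp add: comp distr_std_gaussian_scale v)
  qed
  finally show ?thesis .
qed

text \<open>
Since \<open>sqrt v\<close> times a standard Gaussian has variance \<open>v\<close> for \<open>v = 0\<close> as well, vanishing entries of the
variance profile need no separate treatment after this change of variables.
\<close>
lemma nn_integral_independent_gaussians:
  fixes X :: "'e \<Rightarrow> 'w \<Rightarrow> real"
  assumes "prob_space M" and E: "finite E" and indep: "prob_space.indep_vars M (\<lambda>_. borel) X E"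
    and law: "\<And>e. e \<in> E \<Longrightarrow> distr M borel (X e) = centered_gaussian (v e)" and v: "\<And>e. e \<in> E \<Longrightarrow> 0 \<le> v e"
    and F [measurable]: "F \<in> borel_measurable (\<Pi>\<^sub>M e\<in>E. borel)"
  shows "(\<integral>\<^sup>+\<omega>. F (\<lambda>e\<in>E. X e \<omega>) \<partial>M) = (\<integral>\<^sup>+x. F (\<lambda>e\<in>E. sqrt (v e) * x e) \<partial>(\<Pi>\<^sub>M e\<in>E. std_gaussian))"
proof (cases "E = {}")
  case True
  interpret prob_space M by fact
  show ?thesis using True by (simp add: PiM_empty nn_integral_count_space_finite emeasure_space_1 restrict_def)
next
  case False
  interpret prob_space M by fact
  have [measurable]: "X e \<in> borel_measurable M" if "e \<in> E" for e using indep that by (simp add: indep_vars_def2)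
  have "(\<integral>\<^sup>+\<omega>. F (\<lambda>e\<in>E. X e \<omega>) \<partial>M) = (\<integral>\<^sup>+y. F y \<partial>distr M (\<Pi>\<^sub>M e\<in>E. borel) (\<lambda>\<omega>. \<lambda>e\<in>E. X e \<omega>))"
    by (rule nn_integral_distr[symmetric]) measurable
  also have "distr M (\<Pi>\<^sub>M e\<in>E. borel) (\<lambda>\<omega>. \<lambda>e\<in>E. X e \<omega>) = (\<Pi>\<^sub>M e\<in>E. distr M borel (X e))"
    using indep by (subst (asm) indep_vars_iff_distr_eq_PiM'[OF False]) auto
  also have "\<dots> = (\<Pi>\<^sub>M e\<in>E. centered_gaussian (v e))" by (intro PiM_cong refl law)
  also have "\<dots> = distr (\<Pi>\<^sub>M e\<in>E. std_gaussian) (\<Pi>\<^sub>M e\<in>E. borel) (\<lambda>x. \<lambda>e\<in>E. sqrt (v e) * x e)"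
    by (rule distr_gaussian_product_scale[OF E False v, symmetric])
  also have "(\<integral>\<^sup>+y. F y \<partial>\<dots>) = (\<integral>\<^sup>+x. F (\<lambda>e\<in>E. sqrt (v e) * x e) \<partial>(\<Pi>\<^sub>M e\<in>E. std_gaussian))"
    by (rule nn_integral_distr) measurable
  finally show ?thesis .
qed

section \<open>The multi-species Sherrington-Kirkpatrick model\<close>

lemma sum_symmetric_eq_ordered_pairs:
  fixes f :: "nat \<Rightarrow> nat \<Rightarrow> real"
  assumes A: "finite A" and sym: "\<And>i j. i \<in> A \<Longrightarrow> j \<in> A \<Longrightarrow> f i j = f j i"
  shows "(\<Sum>i\<in>A. \<Sum>j\<in>A. f i j) = 2 * (\<Sum>(i, j)\<in>{(i, j). i \<in> A \<and> j \<in> A \<and> i < j}. f i j) + (\<Sum>i\<in>A. f i i)"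
proof -
  let ?E = "{(i, j). i \<in> A \<and> j \<in> A \<and> i < j}" and ?T = "{(i, j). i \<in> A \<and> j \<in> A \<and> j < i}" and ?D = "(\<lambda>i. (i, i)) ` A"
  have fin: "finite ?E" "finite ?T" "finite ?D"
    using A by (auto intro: finite_subset[of _ "A \<times> A"])
  have "A \<times> A = (?E \<union> ?T) \<union> ?D" by (auto simp: image_iff)
  hence "(\<Sum>i\<in>A. \<Sum>j\<in>A. f i j) = (\<Sum>(i, j)\<in>(?E \<union> ?T) \<union> ?D. f i j)"
    by (simp add: sum.cartesian_product)
  also have "\<dots> = (\<Sum>(i, j)\<in>?E. f i j) + (\<Sum>(i, j)\<in>?T. f i j) + (\<Sum>(i, j)\<in>?D. f i j)"
    using fin by (subst sum.union_disjoint; (subst sum.union_disjoint)?) auto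
  also have "(\<Sum>(i, j)\<in>?T. f i j) = (\<Sum>(i, j)\<in>?E. f i j)"
    by (rule sum.reindex_bij_witness[of _ prod.swap prod.swap]) (auto simp: sym)
  also have "(\<Sum>(i, j)\<in>?D. f i j) = (\<Sum>i\<in>A. f i i)"
    by (subst sum.reindex) (auto simp: inj_on_def)
  finally show ?thesis by simp
qed

text \<open>
Here \<open>sp i\<close> is the species of the site \<open>i\<close>.
\<close>
lemma sum_species_blocks:
  fixes D :: "nat \<Rightarrow> nat \<Rightarrow> real" and q :: "nat \<Rightarrow> real"
  assumes sum_J: "\<And>f :: nat \<Rightarrow> real. (\<Sum>i\<in>J. f i) = (\<Sum>s<m. \<Sum>i\<in>I s. f i)"
    and sp: "\<And>s i. s < m \<Longrightarrow> i \<in> I s \<Longrightarrow> sp i = s"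
  shows "(\<Sum>i\<in>J. \<Sum>j\<in>J. D (sp i) (sp j) * (q i * q j)) = (\<Sum>s<m. \<Sum>t<m. D s t * (\<Sum>i\<in>I s. q i) * (\<Sum>i\<in>I t. q i))"
proof -
  have inner: "(\<Sum>j\<in>J. D (sp i) (sp j) * (q i * q j)) = (\<Sum>t<m. D (sp i) t * q i * (\<Sum>j\<in>I t. q j))" for i
    unfolding sum_J by (auto intro!: sum.cong simp: sp sum_distrib_left mult_ac)
  have "(\<Sum>i\<in>J. \<Sum>j\<in>J. D (sp i) (sp j) * (q i * q j)) = (\<Sum>s<m. \<Sum>i\<in>I s. \<Sum>t<m. D s t * q i * (\<Sum>j\<in>I t. q j))"
    unfolding inner unfolding sum_J by (auto intro!: sum.cong simp: sp)
  also have "\<dots> = (\<Sum>s<m. \<Sum>t<m. \<Sum>i\<in>I s. D s t * q i * (\<Sum>j\<in>I t. q j))"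
    by (intro sum.cong refl sum.swap)
  also have "\<dots> = (\<Sum>s<m. \<Sum>t<m. D s t * (\<Sum>i\<in>I s. q i) * (\<Sum>i\<in>I t. q i))"
    by (simp flip: sum_distrib_left sum_distrib_right)
  finally show ?thesis .
qed

lemma nu_le_of_nn_integral_le:
  assumes "prob_space M" and meas: "(\<lambda>\<omega>. gibbs_average N \<beta> h (\<lambda>i j. g i j \<omega>) F) \<in> borel_measurable M"
    and nonneg: "\<And>\<sigma> \<tau>. 0 \<le> F \<sigma> \<tau>" and K: "0 \<le> K"
    and le: "(\<integral>\<^sup>+\<omega>. ennreal (gibbs_average N \<beta> h (\<lambda>i j. g i j \<omega>) F) \<partial>M) \<le> ennreal K"
  shows "nu N \<beta> h M g F \<le> K"
proof -
  have "0 \<le> gibbs_average N \<beta> h (\<lambda>i j. g i j \<omega>) F" for \<omega>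
    unfolding gibbs_average_def gibbs_def partition_function_def
    by (intro sum_nonneg mult_nonneg_nonneg divide_nonneg_nonneg nonneg) auto
  hence "nu N \<beta> h M g F = enn2real (\<integral>\<^sup>+\<omega>. ennreal (gibbs_average N \<beta> h (\<lambda>i j. g i j \<omega>) F) \<partial>M)"
    unfolding nu_def using meas by (intro integral_eq_nn_integral) auto
  also have "\<dots> \<le> K" using enn2real_mono[OF le] K by simp
  finally show ?thesis .
qed

text \<open>
The model as a high temperature spin system over the pairs of sites: the energies are linear in
standard Gaussians with coefficients \<open>\<beta> / sqrt N * sqrt (\<Delta>\<^sup>2) * \<sigma> i * \<sigma> j\<close>, and the sum over pairs in
the covariance is half the full quadratic form in the overlaps minus a nonnegative diagonal. The bound is free of \<open>N\<close>,
of the partition and of the disorder.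
\<close>
lemma nu_exp_overlap_le:
  fixes m :: nat and Dsq :: "real Matrix.mat" and lam :: "nat \<Rightarrow> real" and \<beta> :: real
  defines "\<rho> \<equiv> spectral_radius (map_mat complex_of_real (Dsq * mat_diag m lam))"
  assumes Dsq: "Dsq \<in> carrier_mat m m" and sym: "transpose_mat Dsq = Dsq"
    and nonneg: "\<And>s t. s < m \<Longrightarrow> t < m \<Longrightarrow> 0 \<le> Dsq $$ (s, t)"
    and lam_pos: "\<And>s. s < m \<Longrightarrow> 0 < lam s"
    and \<gamma>: "0 < \<gamma>" and c: "0 \<le> \<rho>" "(\<beta>\<^sup>2 / 2 + 2 * \<gamma>) * \<rho> < 1 / 2"
    and N: "1 \<le> N" and part: "species_partition N m lam I" and dis: "gaussian_disorder N m Dsq I M g"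
  defines "B \<equiv> (1 / sqrt (1 - 2 * ((\<beta>\<^sup>2 / 2 + 2 * \<gamma>) * \<rho>))) ^ m"
  shows "nu N \<beta> 0 M g (\<lambda>\<sigma> \<tau>. exp (\<gamma> * (real N * P_form m Dsq lam (overlap m I \<sigma> \<tau>))))
     \<le> (B + exp (2 * (\<beta>\<^sup>2 / 2) * B / \<gamma>)) / 2"
proof -
  define J where "J = {1..N}"
  define E where "E = {(i, j). i \<in> J \<and> j \<in> J \<and> i < j}"
  define C where "C = configs N"
  define W where "W \<sigma> \<tau> = real N * P_form m Dsq lam (overlap m I \<sigma> \<tau>)" for \<sigma> \<tau>
  have J: "finite J" "(\<Union>s<m. I s) = J" and disj: "disjoint_family_on I {..<m}"
    and card_I: "\<And>s. s < m \<Longrightarrow> real (card (I s)) = lam s * real N"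
    using part by (auto simp: species_partition_def J_def)
  have card_pos: "0 < real (card (I s))" if "s < m" for s using card_I[OF that] lam_pos[OF that] N by simp
  have I_ne: "I s \<noteq> {}" if "s < m" for s using card_pos[OF that] by auto
  have I_fin: "finite (I s)" if "s < m" for s using J that by (auto intro: finite_subset)
  have "\<forall>i\<in>J. \<exists>s. s < m \<and> i \<in> I s" using J by auto
  then obtain sp where sp: "\<And>i. i \<in> J \<Longrightarrow> sp i < m \<and> i \<in> I (sp i)" by (auto simp: bchoice_iff)
  have sp_eq: "sp i = s" if "s < m" "i \<in> I s" for i s
  proof -
    have "i \<in> J" using that J by auto
    then show ?thesis using sp[of i] that disj unfolding disjoint_family_on_def by blast
  qed
  have sum_J: "(\<Sum>i\<in>J. f i) = (\<Sum>s<m. \<Sum>i\<in>I s. f i)" for f :: "nat \<Rightarrow> real"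
    unfolding J(2)[symmetric] using disj I_fin
    by (intro sum.UNION_disjoint) (auto simp: disjoint_family_on_def)
  have E_fin: "finite E" unfolding E_def using J(1) by (auto intro: finite_subset[of _ "J \<times> J"])
  define v where "v = (\<lambda>(i, j). Dsq $$ (sp i, sp j))"
  have v_nonneg: "0 \<le> v e" if "e \<in> E" for e using that sp nonneg by (auto simp: v_def E_def)
  define a where "a \<sigma> = (\<lambda>(i, j). \<beta> / sqrt (real N) * sqrt (v (i, j)) * (\<sigma> i * \<sigma> j))" for \<sigma> :: "nat \<Rightarrow> real"
  have C_eq: "C = PiE J (\<lambda>_. {-1, 1})" by (simp add: C_def configs_def J_def)
  have C_fin: "finite C" unfolding C_eq using J(1) by (intro finite_PiE) auto
  have C_card: "card C = 2 ^ card J" unfolding C_eq using J(1) by (simp add: card_PiE numeral_2_eq_2)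
  have C_ne: "C \<noteq> {}" using C_card C_fin by auto
  have spin: "(\<sigma> i)\<^sup>2 = 1" if "\<sigma> \<in> C" "i \<in> J" for \<sigma> i
  proof -
    have "\<sigma> i \<in> {-1, 1}" using that unfolding C_eq by (rule PiE_mem)
    then show ?thesis by auto
  qed
  have a_mult: "a \<sigma> e * a \<tau> e = \<beta>\<^sup>2 / real N * (case e of (i, j) \<Rightarrow> v (i, j) * ((\<sigma> i * \<tau> i) * (\<sigma> j * \<tau> j)))"
    if "e \<in> E" for \<sigma> \<tau> e
  proof -
    obtain i j where e: "e = (i, j)" by (cases e)
    have "a \<sigma> e * a \<tau> e = (\<beta> * \<beta>) / (sqrt (real N) * sqrt (real N)) * ((sqrt (v (i, j)) * sqrt (v (i, j))) * ((\<sigma> i * \<tau> i) * (\<sigma> j * \<tau> j)))"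
      by (simp add: a_def e)
    then show ?thesis using v_nonneg[OF that] by (simp add: e power2_eq_square)
  qed
  interpret G: gaussian_spin_system C E a "\<beta>\<^sup>2 / real N * (\<Sum>e\<in>E. v e)"
  proof
    fix \<sigma> assume \<sigma>: "\<sigma> \<in> C"
    have "(a \<sigma> e)\<^sup>2 = \<beta>\<^sup>2 / real N * v e" if e: "e \<in> E" for e
      using a_mult[OF e, of \<sigma> \<sigma>] e spin[OF \<sigma>] by (auto simp: E_def power2_eq_square split: prod.splits)
    then show "(\<Sum>e\<in>E. (a \<sigma> e)\<^sup>2) = \<beta>\<^sup>2 / real N * (\<Sum>e\<in>E. v e)" by (simp add: sum_distrib_left)
  qed (use C_fin C_ne E_fin in auto)
  define R where "R \<sigma> \<tau> s = (\<Sum>i\<in>I s. \<sigma> i * \<tau> i) / real (card (I s))" for \<sigma> \<tau> :: "nat \<Rightarrow> real" and s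
  have ov: "overlap m I \<sigma> \<tau> = Matrix.vec m (R \<sigma> \<tau>)" for \<sigma> \<tau> by (simp add: overlap_def R_def[abs_def])
  have blockR: "(\<Sum>i\<in>I s. \<sigma> i * \<tau> i) = real N * (lam s * R \<sigma> \<tau> s)" if "s < m" for \<sigma> \<tau> s
    using card_I[OF that] lam_pos[OF that] N by (simp add: R_def)
  note P = P_form_bounds[OF Dsq sym lam_pos]
  have P_le: "P_form m Dsq lam (Matrix.vec m r) \<le> \<rho> * (\<Sum>s<m. lam s * (r s)\<^sup>2)" for r
    unfolding \<rho>_def by (rule P(3))
  have W_nonneg: "0 \<le> W \<sigma> \<tau>" for \<sigma> \<tau> unfolding W_def ov using P(2) by simp
  have cov_le: "G.cov \<sigma> \<tau> \<le> \<beta>\<^sup>2 / 2 * W \<sigma> \<tau>" for \<sigma> \<tau>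
  proof -
    define q where "q i = \<sigma> i * \<tau> i" for i
    let ?f = "\<lambda>i j. v (i, j) * (q i * q j)"
    have "G.cov \<sigma> \<tau> = \<beta>\<^sup>2 / real N * (\<Sum>(i, j)\<in>E. ?f i j)"
      unfolding G.cov_def sum_distrib_left by (intro sum.cong refl) (simp add: a_mult q_def)
    also have "\<dots> \<le> \<beta>\<^sup>2 / real N * ((\<Sum>i\<in>J. \<Sum>j\<in>J. ?f i j) / 2)"
    proof (intro mult_left_mono)
      have "Dsq $$ (s, t) = Dsq $$ (t, s)" if "s < m" "t < m" for s t
        using arg_cong[OF sym, of "\<lambda>A. A $$ (s, t)"] that Dsq by simp
      hence "?f i j = ?f j i" if "i \<in> J" "j \<in> J" for i j using that sp by (simp add: v_def)
      from sum_symmetric_eq_ordered_pairs[OF J(1), of ?f, OF this]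
      have "(\<Sum>i\<in>J. \<Sum>j\<in>J. ?f i j) = 2 * (\<Sum>(i, j)\<in>E. ?f i j) + (\<Sum>i\<in>J. ?f i i)" by (simp add: E_def)
      \<comment> \<open>The full form counts every pair twice, and its diagonal terms are nonnegative.\<close>
      moreover have "0 \<le> (\<Sum>i\<in>J. ?f i i)" using sp nonneg by (intro sum_nonneg) (auto simp: v_def)
      ultimately show "(\<Sum>(i, j)\<in>E. ?f i j) \<le> (\<Sum>i\<in>J. \<Sum>j\<in>J. ?f i j) / 2" by simp
    qed auto
    also have "(\<Sum>i\<in>J. \<Sum>j\<in>J. ?f i j) = (\<Sum>s<m. \<Sum>t<m. Dsq $$ (s, t) * (\<Sum>i\<in>I s. q i) * (\<Sum>i\<in>I t. q i))"
      unfolding v_def prod.case by (rule sum_species_blocks[OF sum_J sp_eq])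
    also have "\<dots> = (\<Sum>s<m. \<Sum>t<m. (real N)\<^sup>2 * (Dsq $$ (s, t) * (lam s * R \<sigma> \<tau> s) * (lam t * R \<sigma> \<tau> t)))"
      unfolding q_def by (intro sum.cong refl) (simp add: blockR power2_eq_square)
    also have "\<dots> = (real N)\<^sup>2 * (\<Sum>s<m. \<Sum>t<m. Dsq $$ (s, t) * (lam s * R \<sigma> \<tau> s) * (lam t * R \<sigma> \<tau> t))"
      by (simp only: sum_distrib_left)
    also have "\<beta>\<^sup>2 / real N * ((real N)\<^sup>2 * (\<Sum>s<m. \<Sum>t<m. Dsq $$ (s, t) * (lam s * R \<sigma> \<tau> s) * (lam t * R \<sigma> \<tau> t)) / 2)
       = \<beta>\<^sup>2 / 2 * (real N * (\<Sum>s<m. \<Sum>t<m. Dsq $$ (s, t) * (lam s * R \<sigma> \<tau> s) * (lam t * R \<sigma> \<tau> t)))"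
      using N by (simp add: power2_eq_square)
    also have "\<dots> \<le> \<beta>\<^sup>2 / 2 * W \<sigma> \<tau>"
      unfolding W_def ov by (intro mult_left_mono P(1)) auto
    finally show ?thesis .
  qed
  define k where "k = (\<beta>\<^sup>2 / 2 + 2 * \<gamma>) * \<rho>"
  have k: "0 \<le> k" "k < 1 / 2" using c \<gamma> by (auto simp: k_def)
  have exp_moment: "(\<Sum>\<sigma>\<in>C. \<Sum>\<tau>\<in>C. exp (G.cov \<sigma> \<tau> + 2 * \<gamma> * W \<sigma> \<tau>)) \<le> B * (real (card C))\<^sup>2"
  proof -
    have W_le: "G.cov \<sigma> \<tau> + 2 * \<gamma> * W \<sigma> \<tau> \<le> k * (\<Sum>s<m. (\<Sum>i\<in>I s. \<sigma> i * \<tau> i)\<^sup>2 / real (card (I s)))" for \<sigma> \<tau>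
    proof -
      have "G.cov \<sigma> \<tau> + 2 * \<gamma> * W \<sigma> \<tau> \<le> (\<beta>\<^sup>2 / 2 + 2 * \<gamma>) * W \<sigma> \<tau>"
        using cov_le[of \<sigma> \<tau>] by (simp add: distrib_right)
      also have "\<dots> \<le> (\<beta>\<^sup>2 / 2 + 2 * \<gamma>) * (real N * (\<rho> * (\<Sum>s<m. lam s * (R \<sigma> \<tau> s)\<^sup>2)))"
        unfolding W_def ov using \<gamma> by (intro mult_left_mono P_le) auto
      also have "\<dots> = k * (\<Sum>s<m. real N * (lam s * (R \<sigma> \<tau> s)\<^sup>2))"
        by (simp add: k_def sum_distrib_left mult_ac)
      also have "(\<Sum>s<m. real N * (lam s * (R \<sigma> \<tau> s)\<^sup>2)) = (\<Sum>s<m. (\<Sum>i\<in>I s. \<sigma> i * \<tau> i)\<^sup>2 / real (card (I s)))"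
        using N lam_pos by (intro sum.cong refl) (auto simp: blockR card_I power2_eq_square dest!: lam_pos)
      finally show ?thesis .
    qed
    have "(\<Sum>\<sigma>\<in>C. \<Sum>\<tau>\<in>C. exp (G.cov \<sigma> \<tau> + 2 * \<gamma> * W \<sigma> \<tau>))
       = (\<Sum>\<tau>\<in>C. \<Sum>\<sigma>\<in>C. exp (G.cov \<sigma> \<tau> + 2 * \<gamma> * W \<sigma> \<tau>))" by (rule sum.swap)
    also have "\<dots> \<le> (\<Sum>\<tau>\<in>C. \<Sum>\<sigma>\<in>C. exp (k * (\<Sum>s<m. (\<Sum>i\<in>I s. \<sigma> i * \<tau> i)\<^sup>2 / real (card (I s)))))"
      by (intro sum_mono iffD2[OF exp_le_cancel_iff] W_le)
    also have "\<dots> \<le> (\<Sum>\<tau>\<in>C. 2 ^ card J * B)"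
    proof (intro sum_mono)
      fix \<tau> assume \<tau>: "\<tau> \<in> C"
      show "(\<Sum>\<sigma>\<in>C. exp (k * (\<Sum>s<m. (\<Sum>i\<in>I s. \<sigma> i * \<tau> i)\<^sup>2 / real (card (I s))))) \<le> 2 ^ card J * B"
        unfolding C_eq B_def k_def[symmetric]
        by (rule sum_exp_block_squares_cube_le[OF J disj I_ne spin[OF \<tau>] k])
    qed
    also have "\<dots> = B * (real (card C))\<^sup>2" by (simp add: C_card power2_eq_square)
    finally show ?thesis .
  qed
  interpret H: high_temperature_spin_system C E a "\<beta>\<^sup>2 / real N * (\<Sum>e\<in>E. v e)" W "\<beta>\<^sup>2 / 2" \<gamma> B
    by unfold_locales (use W_nonneg cov_le exp_moment \<gamma> in auto)
  have prob: "prob_space M" and indep: "prob_space.indep_vars M (\<lambda>_. borel) (\<lambda>(i, j). g i j) E"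
    and law: "\<And>s t i j. s < m \<Longrightarrow> t < m \<Longrightarrow> i \<in> I s \<Longrightarrow> j \<in> I t \<Longrightarrow> i < j \<Longrightarrow>
        distr M borel (g i j) = centered_gaussian (Dsq $$ (s, t))"
    using dis by (auto simp: gaussian_disorder_def E_def J_def)
  have law': "distr M borel ((\<lambda>(i, j). g i j) e) = centered_gaussian (v e)" if "e \<in> E" for e
    using that sp by (auto simp: E_def v_def intro!: law)
  define F where "F = (\<lambda>\<sigma> \<tau>. exp (\<gamma> * W \<sigma> \<tau>))"
  define \<Phi> where "\<Phi> y = gibbs_average N \<beta> 0 (\<lambda>i j. y (i, j)) F" for y :: "nat \<times> nat \<Rightarrow> real"
  have ham: "hamiltonian N \<beta> 0 (\<lambda>i j. y (i, j)) \<sigma> = \<beta> / sqrt (real N) * (\<Sum>(i, j)\<in>E. y (i, j) * \<sigma> i * \<sigma> j)" for y \<sigma>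
    by (simp add: hamiltonian_def E_def J_def)
  have \<Phi>_measurable [measurable]: "\<Phi> \<in> borel_measurable (\<Pi>\<^sub>M e\<in>E. borel)"
  proof -
    have "(\<lambda>y. hamiltonian N \<beta> 0 (\<lambda>i j. y (i, j)) \<sigma>) \<in> borel_measurable (\<Pi>\<^sub>M e\<in>E. borel)" for \<sigma>
      unfolding ham case_prod_beta by measurable
    then show ?thesis unfolding \<Phi>_def gibbs_average_def gibbs_def partition_function_def by measurable
  qed
  \<comment> \<open>The Gibbs average reads the couplings only on \<open>E\<close>.\<close>
  have cut: "\<Phi> (\<lambda>e\<in>E. y e) = \<Phi> y" for y
  proof -
    have "hamiltonian N \<beta> 0 (\<lambda>i j. (\<lambda>e\<in>E. y e) (i, j)) \<sigma> = hamiltonian N \<beta> 0 (\<lambda>i j. y (i, j)) \<sigma>" for \<sigma>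
      unfolding ham by (intro arg_cong[where f = "(*) _"] sum.cong) auto
    then show ?thesis by (simp only: \<Phi>_def gibbs_average_def gibbs_def partition_function_def)
  qed
  have \<Phi>_eq: "\<Phi> (\<lambda>e\<in>E. sqrt (v e) * x e) = G.pair_average F x" for x
  proof -
    have h: "hamiltonian N \<beta> 0 (\<lambda>i j. sqrt (v (i, j)) * x (i, j)) \<sigma> = G.energy \<sigma> x" for \<sigma>
      unfolding ham[of "\<lambda>e. sqrt (v e) * x e"] G.energy_def sum_distrib_left
      by (intro sum.cong refl) (auto simp: a_def)
    have "\<Phi> (\<lambda>e\<in>E. sqrt (v e) * x e) = (\<Sum>\<sigma>\<in>C. \<Sum>\<tau>\<in>C. F \<sigma> \<tau> * (exp (G.energy \<sigma> x) / G.Z x) * (exp (G.energy \<tau> x) / G.Z x))"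
      unfolding cut by (simp add: \<Phi>_def gibbs_average_def gibbs_def partition_function_def h G.Z_def C_def[symmetric])
    then show ?thesis
      by (simp add: G.pair_average_def exp_add power2_eq_square sum_divide_distrib mult_ac)
  qed
  have g_eq: "gibbs_average N \<beta> 0 (\<lambda>i j. g i j \<omega>) F = \<Phi> (\<lambda>e\<in>E. (\<lambda>(i, j). g i j) e \<omega>)" for \<omega>
    unfolding cut by (simp add: \<Phi>_def)
  have "(\<integral>\<^sup>+\<omega>. ennreal (gibbs_average N \<beta> 0 (\<lambda>i j. g i j \<omega>) F) \<partial>M)
     = (\<integral>\<^sup>+x. ennreal (\<Phi> (\<lambda>e\<in>E. sqrt (v e) * x e)) \<partial>(\<Pi>\<^sub>M e\<in>E. std_gaussian))"
    unfolding g_eq by (rule nn_integral_independent_gaussians[OF prob E_fin indep law' v_nonneg]) auto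
  also have "\<dots> \<le> ennreal ((B + exp H.tilt) / 2)"
    unfolding \<Phi>_eq F_def by (rule H.exp_moment_pair_average_le)
  finally have le: "(\<integral>\<^sup>+\<omega>. ennreal (gibbs_average N \<beta> 0 (\<lambda>i j. g i j \<omega>) F) \<partial>M) \<le> ennreal ((B + exp H.tilt) / 2)" .
  have X: "(\<lambda>(i, j). g i j) e \<in> borel_measurable M" if "e \<in> E" for e
    using indep[unfolded prob_space.indep_vars_def2[OF prob], THEN conjunct1, THEN bspec, OF that] .
  have "(\<lambda>\<omega>. \<lambda>e\<in>E. (\<lambda>(i, j). g i j) e \<omega>) \<in> measurable M (\<Pi>\<^sub>M e\<in>E. borel)"
    by (rule measurable_restrict) (rule X)
  hence meas: "(\<lambda>\<omega>. gibbs_average N \<beta> 0 (\<lambda>i j. g i j \<omega>) F) \<in> borel_measurable M"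
    unfolding g_eq by (rule measurable_compose[OF _ \<Phi>_measurable])
  have "nu N \<beta> 0 M g F \<le> (B + exp H.tilt) / 2"
    by (rule nu_le_of_nn_integral_le[OF prob meas _ _ le]) (use H.B_nonneg in \<open>auto simp: F_def\<close>)
  then show ?thesis by (simp only: F_def W_def H.tilt_def)
qed

theorem theorem1p8:
  fixes m :: nat and Dsq :: "real Matrix.mat" and lam :: "nat \<Rightarrow> real" and \<beta> h :: real
  assumes "m \<ge> 2"
    and "Dsq \<in> carrier_mat m m"
    and "transpose_mat Dsq = Dsq"
    and "invertible_mat Dsq"
    and "Dsq \<noteq> 0\<^sub>m m m"
    and "\<forall>s<m. \<forall>t<m. Dsq $$ (s, t) \<ge> 0"
    and "\<forall>s<m. 0 < lam s \<and> lam s < 1"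
    and "h = 0"
    and "0 < \<beta>" and "\<beta> < beta_c m Dsq lam"
  shows "\<exists>K::real. \<forall>N\<ge>1. \<forall>(I :: nat \<Rightarrow> nat set) (M :: 'w measure) (g :: nat \<Rightarrow> nat \<Rightarrow> 'w \<Rightarrow> real).
    species_partition N m lam I \<longrightarrow> gaussian_disorder N m Dsq I M g \<longrightarrow>
    nu N \<beta> h M g (\<lambda>\<sigma> \<tau>. exp (1 / 8 * ((beta_c m Dsq lam)\<^sup>2 - \<beta>\<^sup>2) * real N
                                * P_form m Dsq lam (overlap m I \<sigma> \<tau>))) \<le> K"
proof -
  let ?bc = "beta_c m Dsq lam"
  define \<rho> where "\<rho> = spectral_radius (map_mat complex_of_real (Dsq * mat_diag m lam))"
  have carrier: "map_mat complex_of_real (Dsq * mat_diag m lam) \<in> carrier_mat m m"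
    using mult_carrier_mat[OF assms(2) mat_diag_dim[of m lam]] by simp
  have "\<rho> \<noteq> 0" using assms(9,10) by (auto simp: beta_c_def \<rho>_def[symmetric])
  moreover have "0 \<le> \<rho>"
    using spectral_radius_mem_max(1)[OF carrier] assms(1) by (auto simp: \<rho>_def)
  ultimately have \<rho>: "0 < \<rho>" by simp
  \<comment> \<open>If \<open>\<rho>\<close> vanished then \<open>\<beta>\<^sub>c\<close> would be \<open>0 powr (- 1 / 2) = 0\<close>, against \<open>0 < \<beta> < \<beta>\<^sub>c\<close>; so \<open>\<beta>\<^sub>c\<^sup>2\<close> is the
      reciprocal of \<open>\<rho>\<close>.\<close>
  have bc: "?bc\<^sup>2 * \<rho> = 1"
  proof -
    have "?bc\<^sup>2 = \<rho> powr (- 1 / 2) * \<rho> powr (- 1 / 2)"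
      by (simp add: beta_c_def \<rho>_def[symmetric] power2_eq_square)
    also have "\<dots> = \<rho> powr (- 1)" by (simp flip: powr_add)
    finally show ?thesis using \<rho> by (simp add: powr_minus)
  qed
  define \<gamma> where "\<gamma> = (?bc\<^sup>2 - \<beta>\<^sup>2) / 8"
  have "\<beta>\<^sup>2 < ?bc\<^sup>2" using assms(9,10) by (intro power_strict_mono) auto
  hence \<gamma>: "0 < \<gamma>" by (simp add: \<gamma>_def)
  \<comment> \<open>With this \<open>\<gamma>\<close> the coefficient \<open>\<beta>\<^sup>2 / 2 + 2 * \<gamma>\<close> is \<open>(\<beta>\<^sup>2 + \<beta>\<^sub>c\<^sup>2) / 4\<close>.\<close>
  have "(\<beta>\<^sup>2 / 2 + 2 * \<gamma>) * \<rho> < ?bc\<^sup>2 / 2 * \<rho>"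
    using \<open>\<beta>\<^sup>2 < ?bc\<^sup>2\<close> \<rho> by (intro mult_strict_right_mono) (simp_all add: \<gamma>_def field_simps)
  hence c: "(\<beta>\<^sup>2 / 2 + 2 * \<gamma>) * \<rho> < 1 / 2" using bc by simp
  define B where "B = (1 / sqrt (1 - 2 * ((\<beta>\<^sup>2 / 2 + 2 * \<gamma>) * \<rho>))) ^ m"
  have "nu N \<beta> h M g (\<lambda>\<sigma> \<tau>. exp (1 / 8 * (?bc\<^sup>2 - \<beta>\<^sup>2) * real N * P_form m Dsq lam (overlap m I \<sigma> \<tau>)))
      \<le> (B + exp (2 * (\<beta>\<^sup>2 / 2) * B / \<gamma>)) / 2"
    if "1 \<le> N" "species_partition N m lam I" "gaussian_disorder N m Dsq I M g"
    for N and I :: "nat \<Rightarrow> nat set" and M :: "'w measure" and g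
  proof -
    have "nu N \<beta> 0 M g (\<lambda>\<sigma> \<tau>. exp (\<gamma> * (real N * P_form m Dsq lam (overlap m I \<sigma> \<tau>))))
      \<le> (B + exp (2 * (\<beta>\<^sup>2 / 2) * B / \<gamma>)) / 2"
      unfolding B_def \<rho>_def
      by (rule nu_exp_overlap_le[OF assms(2,3) _ _ \<gamma> _ _ that])
        (use assms(6,7) c \<open>0 \<le> \<rho>\<close> in \<open>auto simp: \<rho>_def\<close>)
    then show ?thesis by (simp add: assms(8) \<gamma>_def mult.assoc)
  qed
  then show ?thesis by blast
qed

end
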